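(* Let $1<\rho<\infty$. Let $B^\rho$ be the Busemann function of the exponential corner growth model, and for $x\in\mathbb{Z}^2$ let $a^\rho(x)\in\{-e_1,-e_2\}$ be the first step of the $B^\rho$ Busemann geodesic started at $x$: $a^\rho(x)=-e_1$ if $B^\rho_{x-e_1,x}<B^\rho_{x-e_2,x}$, and $a^\rho(x)=-e_2$ if $B^\rho_{x-e_2,x}\le B^\rho_{x-e_1,x}$. (a) Let $\omega=(\omega_k)_{k\in\mathbb{Z}}$ and $I=(I_k)_{k\in\mathbb{Z}}$ be independent sequences of i.i.d. exponential random variables with means $1$ and $\rho$ respectively. Let $\widetilde I=D(I,\omega)$ and $\eta_k=\mathbf{1}\{\widetilde I_k=\omega_k\}$. Then $$\bigl\{\mathbf{1}\{a^\rho(ke_1)=-e_1\}\bigr\}_{k\in\mathbb{Z}}\overset{d}{=}\{\eta_k\}_{k\in\mathbb{Z}}.$$ (b) Let $x\in\mathbb{Z}^2$ and $\xi_x=\inf\{k\in\mathbb{Z}_{\ge0}:a^\rho(x-ke_1)=-e_2\}$. Then $\mathbb{P}\{\xi_x=0\}=1-\rho^{-1}$ and for $n\in\mathbb{Z}_{>0}$, $$\mathbb{P}\{\xi_x=n\}=(1-\rho^{-1})\sum_{k=0}^{n-1}C(n-1,k)\,\frac{\rho^k}{(\rho+1)^{n+k}},$$ where $C(n,k)=\dfrac{(n+k)!\,(n-k+1)}{k!\,(n+1)!}$ for $0\le k\le n$ (the Catalan triangle).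
   Context: Notation: $e_1=(1,0)$, $e_2=(0,1)$, coordinatewise order on $\mathbb{Z}^2$, $a\wedge b=\min(a,b)$. Weights: $Y=(Y_x)_{x\in\mathbb{Z}^2}$ are i.i.d. exponential with mean $1$. Last-passage values: for $u\le v$ in $\mathbb{Z}^2$, $G_{u,v}=\max\sum_iY_{x_i}$, the maximum over nearest-neighbor paths from $u$ to $v$ with steps in $\{e_1,e_2\}$ (endpoints included). Busemann process (existence known): a process $\{B^\rho_{x,y}:x,y\in\mathbb{Z}^2,\ \rho\in(1,\infty)\}$, cadlag in $\rho$, a Borel function of $Y$, such that: for fixed $\rho$, with $u(\rho)=-\bigl(\frac1{1+(\rho-1)^2},\frac{(\rho-1)^2}{1+(\rho-1)^2}\bigr)$, almost surely $B^\rho_{x,y}=\lim_{n\to\infty}[G_{u_n,y}-G_{u_n,x}]$ for every sequence $u_n\in\mathbb{Z}^2$ with $|u_n|_1\to\infty$ and $u_n/n\to u(\rho)$; and on a single event of probability one, for all $x,y,z$ and all $\lambda<\rho$ in $(1,\infty)$: $B^\lambda_{x,x+e_1}\le B^\rho_{x,x+e_1}$, $B^\lambda_{x,x+e_2}\ge B^\rho_{x,x+e_2}$, $B^\rho_{x,y}+B^\rho_{y,z}=B^\rho_{x,z}$, $Y_x=B^\rho_{x-e_1,x}\wedge B^\rho_{x-e_2,x}$. For fixed $\rho$, $B^\rho$ is stationary under lattice shifts, $B^\rho_{x-e_1,x}$ is exponential with rate $\rho^{-1}$, $B^\rho_{x-e_2,x}$ is exponential with rate $1-\rho^{-1}$,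 and increments $B^\rho_{y_k,y_{k+1}}$ along any down-right path ($y_{k+1}-y_k\in\{e_1,-e_2\}$) are independent. The $B^\rho$ Busemann geodesic from $x$ is the southwest-directed path that from each site $z$ it visits takes the step $a^\rho(z)$; thus $\xi_x$ is the number of consecutive $-e_1$ steps it takes from $x$ before its first $-e_2$ step. Queueing map. For $I,\omega\in\mathbb{R}_{\ge0}^{\mathbb{Z}}$ with $\lim_{m\to-\infty}\sum_{i=m}^0(\omega_i-I_{i+1})=-\infty$, choose any $G:\mathbb{Z}\to\mathbb{R}$ with $I_k=G_k-G_{k-1}$, put $\widetilde G_\ell=\sup_{k\le\ell}\{G_k+\sum_{i=k}^\ell\omega_i\}$, and define $D(I,\omega)=\widetilde I$ with $\widetilde I_\ell=\widetilde G_\ell-\widetilde G_{\ell-1}$ (independent of the choice of $G$). *)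

theory Defs
  imports "HOL-Probability.Probability"
begin

abbreviation e1 :: "int \<times> int" where "e1 \<equiv> (1, 0)"

abbreviation e2 :: "int \<times> int" where "e2 \<equiv> (0, 1)"

definition iid_exponential :: "'a measure \<Rightarrow> real \<Rightarrow> ('i \<Rightarrow> 'a \<Rightarrow> real) \<Rightarrow> bool" where
  \<comment> \<open>\<open>r\<close> is the rate, so the mean is \<open>1 / r\<close>\<close>
  "iid_exponential M r X \<longleftrightarrow>
     prob_space.indep_vars M (\<lambda>_. borel) X UNIV \<and>
     (\<forall>i. distributed M lborel (X i) (exponential_density r))"

definition equal_in_distribution ::
    "'a measure \<Rightarrow> ('a \<Rightarrow> 'c) \<Rightarrow> 'b measure \<Rightarrow> ('b \<Rightarrow> 'c) \<Rightarrow> 'c measure \<Rightarrow> bool" where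
  \<comment> \<open>Measurability is required because \<open>distr\<close> is meaningless for non-measurable maps.\<close>
  "equal_in_distribution M X N Z S \<longleftrightarrow>
     X \<in> measurable M S \<and> Z \<in> measurable N S \<and> distr M S X = distr N S Z"


subsection \<open>Last-passage percolation\<close>

definition up_right_path :: "int \<times> int \<Rightarrow> int \<times> int \<Rightarrow> (int \<times> int) list \<Rightarrow> bool" where
  "up_right_path u v p \<longleftrightarrow>
     p \<noteq> [] \<and> hd p = u \<and> last p = v \<and> successively (\<lambda>x y. y - x \<in> {e1, e2}) p"

definition last_passage ::
    "(int \<times> int \<Rightarrow> real) \<Rightarrow> int \<times> int \<Rightarrow> int \<times> int \<Rightarrow> real" where
  \<comment> \<open>Unspecified unless \<open>u \<le> v\<close> coordinatewise: otherwise there are no paths.\<close>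
  "last_passage Y u v = Max {\<Sum>x\<leftarrow>p. Y x | p. up_right_path u v p}"


subsection \<open>Busemann process of the exponential corner growth model\<close>

definition cadlag_on_Ioi :: "real \<Rightarrow> (real \<Rightarrow> real) \<Rightarrow> bool" where
  "cadlag_on_Ioi a f \<longleftrightarrow>
     (\<forall>r>a. (f \<longlongrightarrow> f r) (at_right r) \<and> (\<exists>l. (f \<longlongrightarrow> l) (at_left r)))"

definition busemann_direction :: "real \<Rightarrow> real \<times> real" where
  "busemann_direction \<rho> = - (1 / (1 + (\<rho> - 1)\<^sup>2), (\<rho> - 1)\<^sup>2 / (1 + (\<rho> - 1)\<^sup>2))"

definition sequence_in_direction :: "real \<times> real \<Rightarrow> (nat \<Rightarrow> int \<times> int) \<Rightarrow> bool" where
  "sequence_in_direction d u \<longleftrightarrow>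
     filterlim (\<lambda>n. \<bar>fst (u n)\<bar> + \<bar>snd (u n)\<bar>) at_top sequentially \<and>
     (\<lambda>n. (real_of_int (fst (u n)) / real n, real_of_int (snd (u n)) / real n)) \<longlonglongrightarrow> d"

definition down_right_path :: "(int \<Rightarrow> int \<times> int) \<Rightarrow> bool" where
  \<comment> \<open>Bi-infinite; every finite down-right path is a segment of one of these.\<close>
  "down_right_path y \<longleftrightarrow> (\<forall>k. y (k + 1) - y k \<in> {e1, - e2})"

locale busemann_process = prob_space M
  for M :: "'a measure" +
  fixes Y :: "int \<times> int \<Rightarrow> 'a \<Rightarrow> real"
    and B :: "real \<Rightarrow> int \<times> int \<Rightarrow> int \<times> int \<Rightarrow> 'a \<Rightarrow> real"
  assumes weights: "iid_exponential M 1 Y"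
    and cadlag: "AE w in M. \<forall>x y. cadlag_on_Ioi 1 (\<lambda>\<rho>. B \<rho> x y w)"
    and function_of_weights: "\<And>\<rho> x y. 1 < \<rho> \<Longrightarrow>
      \<exists>\<Phi> \<in> borel_measurable (PiM UNIV (\<lambda>_. borel)). \<forall>w\<in>space M. B \<rho> x y w = \<Phi> (\<lambda>z. Y z w)"
    and busemann_limit: "\<And>\<rho>. 1 < \<rho> \<Longrightarrow>
      AE w in M. \<forall>x y u. sequence_in_direction (busemann_direction \<rho>) u \<longrightarrow>
        (\<lambda>n. last_passage (\<lambda>z. Y z w) (u n) y - last_passage (\<lambda>z. Y z w) (u n) x)
          \<longlonglongrightarrow> B \<rho> x y w"
    and pathwise: "AE w in M. \<forall>x y z \<sigma> \<rho>. 1 < \<sigma> \<and> \<sigma> < \<rho> \<longrightarrow>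
      B \<sigma> x (x + e1) w \<le> B \<rho> x (x + e1) w \<and>
      B \<sigma> x (x + e2) w \<ge> B \<rho> x (x + e2) w \<and>
      B \<rho> x y w + B \<rho> y z w = B \<rho> x z w \<and>
      Y x w = min (B \<rho> (x - e1) x w) (B \<rho> (x - e2) x w)"
    and stationary: "\<And>\<rho> z. 1 < \<rho> \<Longrightarrow>
      distr M (PiM UNIV (\<lambda>_. borel)) (\<lambda>w (x, y). B \<rho> (x + z) (y + z) w) =
      distr M (PiM UNIV (\<lambda>_. borel)) (\<lambda>w (x, y). B \<rho> x y w)"
    and horizontal: "\<And>\<rho> x. 1 < \<rho> \<Longrightarrow>
      distributed M lborel (B \<rho> (x - e1) x) (exponential_density (1 / \<rho>))"
    and vertical: "\<And>\<rho> x. 1 < \<rho> \<Longrightarrow>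
      distributed M lborel (B \<rho> (x - e2) x) (exponential_density (1 - 1 / \<rho>))"
    and down_right_independent: "\<And>\<rho> y. 1 < \<rho> \<Longrightarrow> down_right_path y \<Longrightarrow>
      indep_vars (\<lambda>_. borel) (\<lambda>k. B \<rho> (y k) (y (k + 1))) UNIV"

definition geodesic_step ::
    "(real \<Rightarrow> int \<times> int \<Rightarrow> int \<times> int \<Rightarrow> 'a \<Rightarrow> real) \<Rightarrow> real \<Rightarrow> int \<times> int \<Rightarrow> 'a \<Rightarrow> int \<times> int" where
  "geodesic_step B \<rho> x w = (if B \<rho> (x - e1) x w < B \<rho> (x - e2) x w then - e1 else - e2)"

definition horizontal_run ::
    "(real \<Rightarrow> int \<times> int \<Rightarrow> int \<times> int \<Rightarrow> 'a \<Rightarrow> real) \<Rightarrow> real \<Rightarrow> int \<times> int \<Rightarrow> 'a \<Rightarrow> enat" where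
  "horizontal_run B \<rho> x w = Inf {enat k | k. geodesic_step B \<rho> (x - (int k, 0)) w = - e2}"


subsection \<open>Queueing map\<close>

definition queue_admissible :: "(int \<Rightarrow> real) \<Rightarrow> (int \<Rightarrow> real) \<Rightarrow> bool" where
  "queue_admissible I \<omega> \<longleftrightarrow> (\<forall>k. 0 \<le> I k \<and> 0 \<le> \<omega> k) \<and>
     filterlim (\<lambda>m::int. \<Sum>i=m..0. \<omega> i - I (i + 1)) at_bot at_bot"

definition queue_sup :: "(int \<Rightarrow> real) \<Rightarrow> (int \<Rightarrow> real) \<Rightarrow> int \<Rightarrow> real" where
  "queue_sup G \<omega> l = (SUP k\<in>{..l}. G k + (\<Sum>i=k..l. \<omega> i))"

definition departure :: "(int \<Rightarrow> real) \<Rightarrow> (int \<Rightarrow> real) \<Rightarrow> int \<Rightarrow> real" where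
  \<comment> \<open>Meaningful only for \<open>queue_admissible I \<omega>\<close>, where the suprema are finite.
     The choice of \<open>G\<close> is then irrelevant, see \<open>departure_eq\<close> below.\<close>
  "departure I \<omega> l =
     (let G = (SOME G. \<forall>k. I k = G k - G (k - 1))
      in queue_sup G \<omega> l - queue_sup G \<omega> (l - 1))"

lemma increments_exist: "\<exists>G. \<forall>k::int. (I k :: real) = G k - G (k - 1)"
proof -
  define G where "G k = (if 0 \<le> k then \<Sum>i=1..k. I i else - (\<Sum>i=k+1..0. I i))" for k :: int
  have "I k = G k - G (k - 1)" for k
  proof -
    consider "k \<ge> 1" | "k = 0" | "k < 0" by linarith
    then show ?thesis
    proof cases
      case 1
      then have "{1..k} = insert k {1..k-1}" by auto
      then show ?thesis using 1 by (simp add: G_def)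
    next
      case 2
      then show ?thesis by (simp add: G_def)
    next
      case 3
      then have "{k..0} = insert k {k+1..0}" by auto
      then show ?thesis using 3 by (simp add: G_def)
    qed
  qed
  then show ?thesis by blast
qed

lemma increments_unique:
  fixes G H :: "int \<Rightarrow> real"
  assumes "\<And>k. G k - G (k - 1) = H k - H (k - 1)"
  shows "H k = G k + (H 0 - G 0)"
proof (induction k rule: int_induct[where k = 0])
  case base
  then show ?case by simp
next
  case (step1 i)
  then show ?case using assms[of "i + 1"] by simp
next
  case (step2 i)
  then show ?case using assms[of i] by simp
qed

lemma queue_sup_bdd_above:
  assumes adm: "queue_admissible I \<omega>" and G: "\<And>k. I k = G k - G (k - 1)"
  shows "bdd_above ((\<lambda>k. G k + (\<Sum>i=k..l. \<omega> i)) ` {..l})"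
proof -
  define f where "f k = G k + (\<Sum>i=k..l. \<omega> i)" for k
  have tele: "(\<Sum>i=m..0. I (i + 1)) = G 1 - G m" if "m \<le> 1" for m
    using that
  proof (induction m rule: int_le_induct)
    case base
    then show ?case by simp
  next
    case (step i)
    have "{i - 1..0} = insert (i - 1) {i..0}" using step by auto
    then show ?case using step G[of i] by simp
  qed
  have "eventually (\<lambda>m. (\<Sum>i=m..0. \<omega> i - I (i + 1)) \<le> 0) at_bot"
    using adm by (auto simp: queue_admissible_def filterlim_at_bot)
  then obtain N where N: "\<And>m. m \<le> N \<Longrightarrow> (\<Sum>i=m..0. \<omega> i - I (i + 1)) \<le> 0"
    by (auto simp: eventually_at_bot_linorder)
  define N' where "N' = min N (min 0 l)"
  have far: "f k \<le> G 1 + (\<Sum>i\<in>{1..l}. \<omega> i)" if "k \<le> N'" for k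
  proof -
    have "(\<Sum>i=k..0. \<omega> i) \<le> G 1 - G k"
      using N[of k] tele[of k] that by (auto simp: N'_def sum_subtractf)
    moreover have "(\<Sum>i=k..l. \<omega> i) \<le> (\<Sum>i\<in>{k..0} \<union> {1..l}. \<omega> i)"
      using adm by (intro sum_mono2) (auto simp: queue_admissible_def)
    moreover have "\<dots> = (\<Sum>i=k..0. \<omega> i) + (\<Sum>i=1..l. \<omega> i)"
      by (intro sum.union_disjoint) auto
    ultimately show ?thesis by (simp add: f_def)
  qed
  have "bdd_above (f ` {..N'})"
    using far by (intro bdd_aboveI2[where M = "G 1 + (\<Sum>i\<in>{1..l}. \<omega> i)"]) auto
  moreover have "bdd_above (f ` {N'..l})" by (intro bdd_above_finite) auto
  moreover have "{..l} = {..N'} \<union> {N'..l}" by (auto simp: N'_def)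
  ultimately have "bdd_above (f ` {..l})" by (simp add: image_Un)
  then show ?thesis by (simp add: f_def[abs_def])
qed

lemma departure_eq:
  assumes adm: "queue_admissible I \<omega>" and G: "\<And>k. I k = G k - G (k - 1)"
  shows "departure I \<omega> l = queue_sup G \<omega> l - queue_sup G \<omega> (l - 1)"
proof -
  define H where "H = (SOME G. \<forall>k. I k = G k - G (k - 1))"
  have H: "I k = H k - H (k - 1)" for k
    using someI_ex[OF increments_exist[of I]] unfolding H_def by blast
  have shift: "H k = G k + (H 0 - G 0)" for k
    by (rule increments_unique[of G H k]) (simp only: G[symmetric] H[symmetric])
  have "queue_sup H \<omega> m = (H 0 - G 0) + queue_sup G \<omega> m" for m
  proof -
    define f where "f k = G k + (\<Sum>i=k..m. \<omega> i)" for k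
    have "H k + (\<Sum>i=k..m. \<omega> i) = (H 0 - G 0) + f k" for k
      using shift[of k] by (simp add: f_def)
    then have "queue_sup H \<omega> m = (SUP k\<in>{..m}. (H 0 - G 0) + f k)"
      by (simp only: queue_sup_def)
    also have "\<dots> = (H 0 - G 0) + (SUP k\<in>{..m}. f k)"
      using queue_sup_bdd_above[OF adm G, of m]
      by (intro Sup_add_eq) (auto simp: f_def[abs_def])
    finally show ?thesis by (simp only: queue_sup_def f_def)
  qed
  then show ?thesis unfolding departure_def Let_def H_def[symmetric] by simp
qed


definition catalan_triangle :: "nat \<Rightarrow> nat \<Rightarrow> real" where
  "catalan_triangle n k = fact (n + k) * (real n - real k + 1) / (fact k * fact (n + 1))"

end

theory Submission
  imports Defs
begin

text \<open>On two consecutive rows the Busemann function is a stationary \<open>M/M/1\<close> queue: the increments on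
  the lower row are the inter-arrival times \<open>I\<close>, the weights on the upper row are the service times
  \<open>\<omega>\<close>, the vertical increments \<open>J\<close> are sojourn times with
  \<open>J k = \<omega> k + max 0 (J (k - 1) - I k)\<close>, and the increments on the upper row are the departures. The
  geodesic moves west at \<open>k\<close> iff \<open>I k < J (k - 1)\<close>, that is, iff the queue is not empty when customer
  \<open>k\<close> arrives. Since a Busemann increment is a limit of passage-time differences, it is a function
  of the weights to its southwest; hence \<open>I\<close> and \<open>\<omega>\<close> are independent. The queue empties infinitely often in
  the past, so \<open>J\<close> is the solution given by the supremum formula, which is part (a). For part (b),
  a run of length \<open>n\<close> is a busy period: started from an exponential workload, the law of the workload
  after \<open>n\<close> steps is a mixture of Erlang laws whose weights count ballot paths.\<close>

subsection \<open>The Catalan triangle\<close>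

text \<open>The geodesic runs west while the time of the queue runs east, so a run of length
  \<open>n\<close> from \<open>x\<close> is read from its far end \<open>z = x - (n, 0)\<close>: the
  geodesic turns at \<open>z\<close>, and each of the next \<open>n\<close> arrivals finds the queue
  busy. The turn fixes the starting workload: it is the smaller of two independent exponentials
  whose rates \<open>1 - 1 / \<rho>\<close> and \<open>1 / \<rho>\<close> add up to 1, hence has
  mass \<open>1 - 1 / \<rho>\<close> and the rate of a service. This coincidence keeps all later
  laws Erlang with a single rate. Independence has to cover both increments at \<open>z\<close> and
  everything east of it, which calls for a path with a corner at \<open>z\<close>. Laws of the
  workload are expressed by integrals of test functions, so no conditional law is formed. The same
  killed chain, started without the turn, also yields the emptying of the queue in the past: an
  exponential moment replaces a law of large numbers.\<close>

lemma catalan_triangle_0 [simp]: "catalan_triangle n 0 = 1"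
  by (simp add: catalan_triangle_def divide_simps)

text \<open>The factor \<open>n - k + 1\<close> vanishes just outside the triangle. This boundary
  value lets sums over row \<open>n\<close> run up to \<open>Suc n\<close>, the last index of row
  \<open>Suc n\<close>.\<close>

lemma catalan_triangle_eq_0 [simp]: "catalan_triangle n (Suc n) = 0"
  by (simp add: catalan_triangle_def)

lemma catalan_triangle_nonneg: "k \<le> Suc n \<Longrightarrow> 0 \<le> catalan_triangle n k"
  by (auto simp: catalan_triangle_def intro!: divide_nonneg_nonneg mult_nonneg_nonneg)

lemma catalan_triangle_Suc:
  "catalan_triangle (Suc n) (Suc k) = catalan_triangle (Suc n) k + catalan_triangle n (Suc k)"
proof -
  have "fact (Suc n + Suc k) = (2 + real n + real k) * fact (Suc (n + k))"
    by (simp add: algebra_simps)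
  then show ?thesis
    unfolding catalan_triangle_def
    by (simp add: divide_simps del: of_nat_Suc) (simp add: algebra_simps)
qed

text \<open>The form in which the triangle arises here: one step of the workload chain replaces a
  row of weights by its partial sums.\<close>

lemma catalan_triangle_sum: "catalan_triangle (Suc n) k = (\<Sum>i\<le>k. catalan_triangle n i)"
  by (induction k) (simp_all add: catalan_triangle_Suc)

subsection \<open>One service step applied to Erlang laws\<close>

lemma nn_integral_erlang: "0 < l \<Longrightarrow> (\<integral>\<^sup>+x. ennreal (erlang_density k l x) \<partial>lborel) = 1"
  using nn_integral_erlang_ith_moment[of l k 0] by simp

text \<open>The waiting time for point \<open>k + 1\<close> of a Poisson process exceeds
  \<open>z\<close> iff at most \<open>k\<close> points fall before \<open>z\<close>. The finite sum
  is the source of the Erlang mixtures below.\<close>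

lemma nn_integral_erlang_tail:
  assumes l: "0 < l" and z: "0 \<le> z"
  shows "(\<integral>\<^sup>+x. ennreal (erlang_density k l x) * indicator {z<..} x \<partial>lborel)
    = ennreal (\<Sum>n\<le>k. (l * z)^n * exp (- l * z) / fact n)"
proof -
  let ?D = "density lborel (erlang_density k l)"
  interpret prob_space ?D using l by (rule prob_space_erlang_density)
  have "(\<integral>\<^sup>+x. ennreal (erlang_density k l x) * indicator {z<..} x \<partial>lborel) = emeasure ?D {z<..}"
    by (simp add: emeasure_density)
  also have "emeasure ?D {z<..} = emeasure ?D (space ?D - {..z})"
    by (rule arg_cong[where f = "emeasure ?D"]) auto
  also have "\<dots> = 1 - emeasure ?D {..z}"
    by (subst emeasure_compl) (auto simp: emeasure_space_1[simplified])
  also have "emeasure ?D {..z} = ennreal (erlang_CDF k l z)"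
    using l by (rule emeasure_erlang_density)
  also have "1 - ennreal (erlang_CDF k l z) = ennreal (1 - erlang_CDF k l z)"
    using l by (metis ennreal_1 ennreal_minus erlang_CDF_nonneg)
  finally show ?thesis using z by (simp add: erlang_CDF_def)
qed

text \<open>Exponential tilting changes the rate from \<open>l\<close> to \<open>l - t\<close>.
  Negative \<open>t\<close> is used for the arrivals, positive \<open>t\<close> for the
  services.\<close>

lemma nn_integral_exponential_exp:
  assumes "0 < l" "t < l"
  shows "(\<integral>\<^sup>+x. ennreal (exponential_density l x) * ennreal (exp (t * x)) \<partial>lborel) = ennreal (l / (l - t))"
proof -
  have "(\<integral>\<^sup>+x. ennreal (exponential_density l x) * ennreal (exp (t * x)) \<partial>lborel)
    = (\<integral>\<^sup>+x. ennreal (l / (l - t)) * ennreal (exponential_density (l - t) x) \<partial>lborel)"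
    using assms by (intro nn_integral_cong)
      (auto simp: exponential_density_def ennreal_mult[symmetric] exp_add[symmetric], simp add: algebra_simps)
  also have "\<dots> = ennreal (l / (l - t))"
    using assms by (simp add: nn_integral_cmult nn_integral_erlang)
  finally show ?thesis .
qed

lemma nn_integral_lborel_shift:
  fixes f :: "real \<Rightarrow> ennreal"
  assumes [measurable]: "f \<in> borel_measurable borel"
  shows "(\<integral>\<^sup>+x. f (c + x) \<partial>lborel) = (\<integral>\<^sup>+x. f x \<partial>lborel)"
  using nn_integral_real_affine[of f 1 c] by simp

lemma nn_integral_convolution:
  fixes f g \<phi> :: "real \<Rightarrow> ennreal"
  assumes [measurable]: "f \<in> borel_measurable borel" "g \<in> borel_measurable borel" "\<phi> \<in> borel_measurable borel"
  shows "(\<integral>\<^sup>+x. \<integral>\<^sup>+y. f x * (g y * \<phi> (x + y)) \<partial>lborel \<partial>lborel)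
    = (\<integral>\<^sup>+z. (\<integral>\<^sup>+y. f (z - y) * g y \<partial>lborel) * \<phi> z \<partial>lborel)"
proof -
  have "(\<integral>\<^sup>+x. \<integral>\<^sup>+y. f x * (g y * \<phi> (x + y)) \<partial>lborel \<partial>lborel)
      = (\<integral>\<^sup>+y. \<integral>\<^sup>+x. f x * (g y * \<phi> (x + y)) \<partial>lborel \<partial>lborel)"
    by (rule lborel_pair.Fubini') simp
  also have "\<dots> = (\<integral>\<^sup>+y. \<integral>\<^sup>+z. f (z - y) * (g y * \<phi> z) \<partial>lborel \<partial>lborel)"
  proof (rule nn_integral_cong)
    fix y :: real
    show "(\<integral>\<^sup>+x. f x * (g y * \<phi> (x + y)) \<partial>lborel) = (\<integral>\<^sup>+z. f (z - y) * (g y * \<phi> z) \<partial>lborel)"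
      using nn_integral_lborel_shift[of "\<lambda>z. f (z - y) * (g y * \<phi> z)" y] by (simp add: add.commute)
  qed
  also have "\<dots> = (\<integral>\<^sup>+z. \<integral>\<^sup>+y. f (z - y) * (g y * \<phi> z) \<partial>lborel \<partial>lborel)"
    by (rule lborel_pair.Fubini') simp
  also have "\<dots> = (\<integral>\<^sup>+z. (\<integral>\<^sup>+y. f (z - y) * g y \<partial>lborel) * \<phi> z \<partial>lborel)"
    by (simp add: nn_integral_multc[symmetric] mult.assoc)
  finally show ?thesis .
qed

text \<open>The operator \<open>\<phi> \<mapsto> E[\<phi>(y - I + W); I < y]\<close> with \<open>I\<close> of rate \<open>r\<close> and \<open>W\<close> of rate 1.\<close>
definition workload_kernel :: "real \<Rightarrow> (real \<Rightarrow> ennreal) \<Rightarrow> real \<Rightarrow> ennreal" where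
  "workload_kernel r \<phi> y = (\<integral>\<^sup>+s. \<integral>\<^sup>+t. ennreal (exponential_density r s) *
     (ennreal (exponential_density 1 t) * (indicator {..<y} s * \<phi> (y - s + t))) \<partial>lborel \<partial>lborel)"

lemma borel_measurable_workload_kernel [measurable]:
  assumes [measurable]: "\<phi> \<in> borel_measurable borel"
  shows "workload_kernel r \<phi> \<in> borel_measurable borel"
proof -
  have [measurable]: "Measurable.pred (borel \<Otimes>\<^sub>M borel) (\<lambda>x :: real \<times> real. snd x \<in> {..<fst x})"
    by simp
  show ?thesis
  unfolding workload_kernel_def[abs_def] by measurable
qed

text \<open>\<open>erlang_density m 1\<close> is the law of \<open>m + 1\<close> rate-1 services, and \<open>r / (1 + r)\<close> is the probability that an
  arrival precedes a service; by memorylessness \<open>m - j\<close> services are completed before the arrival.\<close>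
lemma erlang_overshoot:
  assumes r: "0 < r" and z: "0 < z"
  shows "(\<integral>\<^sup>+s. ennreal (exponential_density r s) * ennreal (erlang_density m 1 (z + s)) \<partial>lborel)
    = (\<Sum>j\<le>m. ennreal (r / (1 + r) * (1 / (1 + r)) ^ (m - j)) * ennreal (erlang_density j 1 z))"
proof -
  \<comment> \<open>\<open>exp (r * z)\<close> comes from shifting the arrival density by
    \<open>z\<close>, and the power of \<open>1 + r\<close> cancels the normalisation of the Erlang
    density of rate \<open>1 + r\<close>.\<close>
  let ?c = "r * exp (r * z) / (1 + r) ^ Suc m"
  have "(\<integral>\<^sup>+s. ennreal (exponential_density r s) * ennreal (erlang_density m 1 (z + s)) \<partial>lborel)
      = (\<integral>\<^sup>+y. ennreal (exponential_density r (y - z)) * ennreal (erlang_density m 1 y) \<partial>lborel)"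
    using nn_integral_lborel_shift[of "\<lambda>y. ennreal (exponential_density r (y - z)) * ennreal (erlang_density m 1 y)" z]
    by simp
  also have "\<dots> = (\<integral>\<^sup>+y. ennreal ?c * (ennreal (erlang_density m (1 + r) y) * indicator {z<..} y) \<partial>lborel)"
  \<comment> \<open>The sides differ at \<open>y = z\<close>: the exponential density is positive at
    0, while the indicator is of an open half-line.\<close>
  proof (rule nn_integral_cong_AE, rule AE_mp[OF AE_lborel_singleton[of z]], intro AE_I2 impI)
    fix y assume "y \<noteq> z"
    show "ennreal (exponential_density r (y - z)) * ennreal (erlang_density m 1 y)
       = ennreal ?c * (ennreal (erlang_density m (1 + r) y) * indicator {z<..} y)"
    proof (cases "z < y")
      case True
      have "exp (- (r * (y - z))) * exp (- y) = exp (r * z) * exp ((- 1 - r) * y)"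
        by (simp add: exp_add[symmetric] algebra_simps)
      then have "exponential_density r (y - z) * erlang_density m 1 y = ?c * erlang_density m (1 + r) y"
        using True z r by (simp add: exponential_density_def erlang_density_def)
      then show ?thesis
        using True z r by (simp add: ennreal_mult[symmetric])
    next
      case False
      then show ?thesis using \<open>y \<noteq> z\<close> by (simp add: exponential_density_def)
    qed
  qed
  also have "\<dots> = ennreal ?c * ennreal (\<Sum>j\<le>m. ((1 + r) * z)^j * exp (- (1 + r) * z) / fact j)"
    using r z by (simp add: nn_integral_cmult nn_integral_erlang_tail del: exp_minus)
  also have "\<dots> = ennreal (\<Sum>j\<le>m. ?c * (((1 + r) * z)^j * exp (- (1 + r) * z) / fact j))"
    using r z by (subst ennreal_mult[symmetric]) (auto simp: sum_distrib_left intro!: sum_nonneg)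
  also have "(\<Sum>j\<le>m. ?c * (((1 + r) * z)^j * exp (- (1 + r) * z) / fact j))
      = (\<Sum>j\<le>m. r / (1 + r) * (1 / (1 + r)) ^ (m - j) * erlang_density j 1 z)"
  proof (intro sum.cong refl)
    fix j assume "j \<in> {..m}"
    then have *: "(1 + r) ^ m = (1 + r) ^ (m - j) * (1 + r) ^ j"
      by (simp add: power_add[symmetric])
    have **: "exp (r * z) * exp (- (1 + r) * z) = exp (- z)"
      by (simp add: exp_add[symmetric] algebra_simps)
    have "?c * (((1 + r) * z)^j * exp (- (1 + r) * z) / fact j)
      = r * (exp (r * z) * exp (- (1 + r) * z)) * ((1 + r) * z)^j / ((1 + r) ^ Suc m * fact j)"
      by simp
    also have "\<dots> = r / (1 + r) * (1 / (1 + r)) ^ (m - j) * erlang_density j 1 z"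
      unfolding ** using r z
      by (simp add: erlang_density_def power_mult_distrib power_divide * mult_ac)
    finally show "?c * (((1 + r) * z)^j * exp (- (1 + r) * z) / fact j)
      = r / (1 + r) * (1 / (1 + r)) ^ (m - j) * erlang_density j 1 z" .
  qed
  also have "ennreal \<dots> = (\<Sum>j\<le>m. ennreal (r / (1 + r) * (1 / (1 + r)) ^ (m - j)) * ennreal (erlang_density j 1 z))"
    using r by (subst sum_ennreal[symmetric]) (auto simp: ennreal_mult[symmetric] intro!: sum.cong)
  finally show ?thesis .
qed

lemma erlang_add_exponential:
  assumes [measurable]: "\<phi> \<in> borel_measurable borel"
  shows "(\<integral>\<^sup>+z. \<integral>\<^sup>+t. ennreal (erlang_density j 1 z) * (ennreal (exponential_density 1 t) * \<phi> (z + t)) \<partial>lborel \<partial>lborel)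
    = (\<integral>\<^sup>+y. ennreal (erlang_density (Suc j) 1 y) * \<phi> y \<partial>lborel)"
  using fun_cong[OF convolution_erlang_density[of 1 j 0]]
  by (subst nn_integral_convolution) simp_all

text \<open>In the variable \<open>z = y - s\<close> the arrival leaves a mixture of Erlang laws for
  the remaining work; the new service then raises each index by one.\<close>

lemma workload_kernel_erlang:
  assumes r: "0 < r" and [measurable]: "\<phi> \<in> borel_measurable borel"
  shows "(\<integral>\<^sup>+y. ennreal (erlang_density m 1 y) * workload_kernel r \<phi> y \<partial>lborel)
    = (\<Sum>j\<le>m. ennreal (r / (1 + r) * (1 / (1 + r)) ^ (m - j)) *
        (\<integral>\<^sup>+y. ennreal (erlang_density (Suc j) 1 y) * \<phi> y \<partial>lborel))"
proof -
  define \<psi> where "\<psi> z = (\<integral>\<^sup>+t. ennreal (exponential_density 1 t) * \<phi> (z + t) \<partial>lborel)" for z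
  have [measurable]: "\<psi> \<in> borel_measurable borel"
    unfolding \<psi>_def[abs_def] by measurable
  have "(\<integral>\<^sup>+y. ennreal (erlang_density m 1 y) * workload_kernel r \<phi> y \<partial>lborel)
    = (\<integral>\<^sup>+y. \<integral>\<^sup>+s. ennreal (erlang_density m 1 y) * (ennreal (exponential_density r s) *
        (indicator {0<..} (y - s) * \<psi> (y - s))) \<partial>lborel \<partial>lborel)"
    unfolding workload_kernel_def \<psi>_def
    by (auto simp: nn_integral_cmult[symmetric] ac_simps intro!: nn_integral_cong split: split_indicator)
  also have "\<dots> = (\<integral>\<^sup>+s. \<integral>\<^sup>+y. ennreal (erlang_density m 1 y) * (ennreal (exponential_density r s) *
        (indicator {0<..} (y - s) * \<psi> (y - s))) \<partial>lborel \<partial>lborel)"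
    by (rule lborel_pair.Fubini') simp
  also have "\<dots> = (\<integral>\<^sup>+s. \<integral>\<^sup>+z. ennreal (erlang_density m 1 (z + s)) * (ennreal (exponential_density r s) *
        (indicator {0<..} z * \<psi> z)) \<partial>lborel \<partial>lborel)"
  proof (rule nn_integral_cong)
    fix s :: real
    show "(\<integral>\<^sup>+y. ennreal (erlang_density m 1 y) * (ennreal (exponential_density r s) *
        (indicator {0<..} (y - s) * \<psi> (y - s))) \<partial>lborel) = (\<integral>\<^sup>+z. ennreal (erlang_density m 1 (z + s)) *
        (ennreal (exponential_density r s) * (indicator {0<..} z * \<psi> z)) \<partial>lborel)"
      using nn_integral_lborel_shift[of "\<lambda>y. ennreal (erlang_density m 1 y) * (ennreal (exponential_density r s) *
        (indicator {0<..} (y - s) * \<psi> (y - s)))" s] by (simp add: add.commute)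
  qed
  also have "\<dots> = (\<integral>\<^sup>+z. \<integral>\<^sup>+s. ennreal (erlang_density m 1 (z + s)) * (ennreal (exponential_density r s) *
        (indicator {0<..} z * \<psi> z)) \<partial>lborel \<partial>lborel)"
    by (rule lborel_pair.Fubini') simp
  also have "\<dots> = (\<integral>\<^sup>+z. (\<integral>\<^sup>+s. ennreal (exponential_density r s) * ennreal (erlang_density m 1 (z + s)) \<partial>lborel)
        * (indicator {0<..} z * \<psi> z) \<partial>lborel)"
    by (subst nn_integral_multc[symmetric]) (auto simp: ac_simps)
  also have "\<dots> = (\<integral>\<^sup>+z. (\<Sum>j\<le>m. ennreal (r / (1 + r) * (1 / (1 + r)) ^ (m - j)) *
        (ennreal (erlang_density j 1 z) * \<psi> z)) \<partial>lborel)"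
  proof (rule nn_integral_cong_AE, rule AE_mp[OF AE_lborel_singleton[of 0]], intro AE_I2 impI)
    fix z :: real assume "z \<noteq> 0"
    then consider "z < 0" | "0 < z" by linarith
    then show "(\<integral>\<^sup>+s. ennreal (exponential_density r s) * ennreal (erlang_density m 1 (z + s)) \<partial>lborel)
        * (indicator {0<..} z * \<psi> z) = (\<Sum>j\<le>m. ennreal (r / (1 + r) * (1 / (1 + r)) ^ (m - j)) *
        (ennreal (erlang_density j 1 z) * \<psi> z))"
      by cases (simp_all add: erlang_density_def[of _ _ z] erlang_overshoot[OF r] sum_distrib_right mult.assoc)
  qed
  also have "\<dots> = (\<Sum>j\<le>m. ennreal (r / (1 + r) * (1 / (1 + r)) ^ (m - j)) *
        (\<integral>\<^sup>+y. ennreal (erlang_density (Suc j) 1 y) * \<phi> y \<partial>lborel))"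
    by (simp add: nn_integral_sum nn_integral_cmult \<psi>_def erlang_add_exponential[symmetric])
  finally show ?thesis .
qed

text \<open>Dropping the constraint \<open>I < y\<close> only increases the integral, and without it
  the exponential moments of arrival and service factor.\<close>

lemma workload_kernel_exp:
  assumes r: "0 < r" and t: "0 \<le> t" "t < 1"
  shows "workload_kernel r (\<lambda>y. ennreal (exp (t * y))) y
    \<le> ennreal (r / (r + t) * (1 / (1 - t))) * ennreal (exp (t * y))"
proof -
  have "workload_kernel r (\<lambda>y. ennreal (exp (t * y))) y \<le>
    (\<integral>\<^sup>+s. \<integral>\<^sup>+u. ennreal (exp (t * y)) * ((ennreal (exponential_density r s) * ennreal (exp ((-t) * s))) *
      (ennreal (exponential_density 1 u) * ennreal (exp (t * u)))) \<partial>lborel \<partial>lborel)"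
    unfolding workload_kernel_def
  proof (intro nn_integral_mono)
    fix s u
    have "exp (t * (y - s + u)) = exp (t * y) * (exp ((-t) * s) * exp (t * u))"
      by (simp add: exp_add[symmetric] algebra_simps)
    then have *: "ennreal (exp (t * (y - s + u))) = ennreal (exp (t * y)) * (ennreal (exp ((-t) * s)) * ennreal (exp (t * u)))"
      by (simp add: ennreal_mult[symmetric])
    show "ennreal (exponential_density r s) * (ennreal (exponential_density 1 u) *
        (indicator {..<y} s * ennreal (exp (t * (y - s + u)))))
      \<le> ennreal (exp (t * y)) * ((ennreal (exponential_density r s) * ennreal (exp ((-t) * s))) *
      (ennreal (exponential_density 1 u) * ennreal (exp (t * u))))"
      unfolding * by (auto simp: ac_simps split: split_indicator)
  qed
  also have "\<dots> = ennreal (exp (t * y)) * (ennreal (r / (r - (-t))) * ennreal (1 / (1 - t)))"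
    using r t nn_integral_exponential_exp[of r "-t"] nn_integral_exponential_exp[of 1 t]
    by (simp add: nn_integral_cmult nn_integral_multc)
  also have "\<dots> = ennreal (r / (r + t) * (1 / (1 - t))) * ennreal (exp (t * y))"
    using r t by (subst ennreal_mult) (auto simp: mult.commute)
  finally show ?thesis .
qed

subsection \<open>The workload killed when the queue empties\<close>

lemma (in prob_space) nn_integral_indep_pair:
  assumes ind: "indep_var S X T Y" and [measurable]: "f \<in> borel_measurable (S \<Otimes>\<^sub>M T)"
  shows "(\<integral>\<^sup>+w. f (X w, Y w) \<partial>M) = (\<integral>\<^sup>+w. \<integral>\<^sup>+w'. f (X w, Y w') \<partial>M \<partial>M)"
proof -
  have [measurable]: "X \<in> measurable M S" "Y \<in> measurable M T"
    and D: "distr M S X \<Otimes>\<^sub>M distr M T Y = distr M (S \<Otimes>\<^sub>M T) (\<lambda>x. (X x, Y x))"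
    using ind by (auto simp: indep_var_distribution_eq)
  interpret X: prob_space "distr M S X" by (rule prob_space_distr) simp
  interpret Y: prob_space "distr M T Y" by (rule prob_space_distr) simp
  have "(\<integral>\<^sup>+w. f (X w, Y w) \<partial>M) = (\<integral>\<^sup>+z. f z \<partial>distr M (S \<Otimes>\<^sub>M T) (\<lambda>x. (X x, Y x)))"
    by (subst nn_integral_distr) simp_all
  also have "\<dots> = (\<integral>\<^sup>+x. \<integral>\<^sup>+y. f (x, y) \<partial>distr M T Y \<partial>distr M S X)"
    unfolding D[symmetric] by (subst Y.nn_integral_fst[symmetric]) simp_all
  also have "\<dots> = (\<integral>\<^sup>+w. (\<integral>\<^sup>+y. f (X w, y) \<partial>distr M T Y) \<partial>M)"
    by (subst nn_integral_distr) simp_all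
  also have "\<dots> = (\<integral>\<^sup>+w. \<integral>\<^sup>+w'. f (X w, Y w') \<partial>M \<partial>M)"
  proof (rule nn_integral_cong)
    fix w assume w: "w \<in> space M"
    have [measurable]: "(\<lambda>y. f (X w, y)) \<in> borel_measurable T"
      using measurable_space[OF \<open>X \<in> measurable M S\<close> w] by simp
    show "(\<integral>\<^sup>+y. f (X w, y) \<partial>distr M T Y) = (\<integral>\<^sup>+w'. f (X w, Y w') \<partial>M)"
      by (subst nn_integral_distr) simp_all
  qed
  finally show ?thesis .
qed

text \<open>A Markov property: \<open>X\<close> records the past, from which \<open>g\<close>
  computes the current workload, and \<open>Y\<close> carries the next arrival and service, read off
  by \<open>\<iota>\<close> and \<open>\<upsilon>\<close>. With the past frozen, integrating over
  \<open>Y\<close> produces the kernel.\<close>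

lemma (in prob_space) workload_one_step:
  fixes I W :: "'a \<Rightarrow> real"
  assumes XY: "indep_var S X T (\<lambda>w. Y w)"
    and g [measurable]: "g \<in> borel_measurable S"
    and YI: "\<iota> \<in> borel_measurable T" "\<And>w. \<iota> (Y w) = I w"
    and YW: "\<upsilon> \<in> borel_measurable T" "\<And>w. \<upsilon> (Y w) = W w"
    and IW: "indep_var borel I borel W"
    and I: "distributed M lborel I (exponential_density r)"
    and W: "distributed M lborel W (exponential_density 1)"
    and [measurable]: "\<phi> \<in> borel_measurable borel"
  shows "(\<integral>\<^sup>+w. (if 0 < g (X w) \<and> I w < g (X w) then \<phi> (g (X w) - I w + W w) else 0) \<partial>M)
    = (\<integral>\<^sup>+w. indicator {0<..} (g (X w)) * workload_kernel r \<phi> (g (X w)) \<partial>M)"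
proof -
  define f where "f = (\<lambda>(v :: real, i, u). indicator {0<..} v * (indicator {..<v} i * \<phi> (v - i + u)))"
  have pred [measurable]: "Measurable.pred (borel \<Otimes>\<^sub>M borel \<Otimes>\<^sub>M borel) (\<lambda>x :: real \<times> real \<times> real. fst (snd x) \<in> {..<fst x})"
    by simp
  have f [measurable]: "f \<in> borel_measurable (borel \<Otimes>\<^sub>M borel \<Otimes>\<^sub>M borel)"
    unfolding f_def case_prod_beta' by measurable
  have fv [measurable]: "(\<lambda>z. f (v, z)) \<in> borel_measurable (borel \<Otimes>\<^sub>M borel)" for v
    by simp
  have [measurable]: "I \<in> borel_measurable M" "W \<in> borel_measurable M"
    using distributed_measurable[OF I] distributed_measurable[OF W] by simp_all
  note YI(1) [measurable] YW(1) [measurable]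
  have inner: "(\<integral>\<^sup>+w'. f (v, I w', W w') \<partial>M) = indicator {0<..} v * workload_kernel r \<phi> v" for v
  proof -
    have "(\<integral>\<^sup>+w'. f (v, I w', W w') \<partial>M) = (\<integral>\<^sup>+w. \<integral>\<^sup>+w'. f (v, I w, W w') \<partial>M \<partial>M)"
      using nn_integral_indep_pair[OF IW, of "\<lambda>z. f (v, z)"] by simp
    also have "\<dots> = (\<integral>\<^sup>+w. (\<integral>\<^sup>+u. exponential_density 1 u * f (v, I w, u) \<partial>lborel) \<partial>M)"
      using distributed_nn_integral[OF W, of "\<lambda>u. f (v, i, u)" for i] by simp
    also have "\<dots> = (\<integral>\<^sup>+i. exponential_density r i * (\<integral>\<^sup>+u. exponential_density 1 u * f (v, i, u) \<partial>lborel) \<partial>lborel)"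
      by (rule distributed_nn_integral[OF I, symmetric]) simp
    also have "\<dots> = indicator {0<..} v * workload_kernel r \<phi> v"
      unfolding workload_kernel_def f_def
      by (auto simp: nn_integral_cmult[symmetric] ac_simps intro!: nn_integral_cong split: split_indicator)
    finally show ?thesis .
  qed
  have "(\<integral>\<^sup>+w. (if 0 < g (X w) \<and> I w < g (X w) then \<phi> (g (X w) - I w + W w) else 0) \<partial>M)
    = (\<integral>\<^sup>+w. (\<lambda>(x, y). f (g x, \<iota> y, \<upsilon> y)) (X w, Y w) \<partial>M)"
    by (intro nn_integral_cong) (auto simp: f_def YI YW split: split_indicator)
  also have "\<dots> = (\<integral>\<^sup>+w. \<integral>\<^sup>+w'. (\<lambda>(x, y). f (g x, \<iota> y, \<upsilon> y)) (X w, Y w') \<partial>M \<partial>M)"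
    using XY by (rule nn_integral_indep_pair) simp
  also have "\<dots> = (\<integral>\<^sup>+w. \<integral>\<^sup>+w'. f (g (X w), I w', W w') \<partial>M \<partial>M)"
    by (simp add: YI YW)
  also have "\<dots> = (\<integral>\<^sup>+w. indicator {0<..} (g (X w)) * workload_kernel r \<phi> (g (X w)) \<partial>M)"
    by (simp add: inner)
  finally show ?thesis .
qed

text \<open>After a survived step the workload \<open>y - s + t\<close> is positive, since
  \<open>s < y\<close> and services are nonnegative. Hence the restriction to surviving paths can be
  reinserted at each step at no cost.\<close>

lemma workload_kernel_restrict_pos:
  "workload_kernel r (\<lambda>y. indicator {0<..} y * \<phi> y) = workload_kernel r \<phi>"
  unfolding workload_kernel_def
  by (auto intro!: nn_integral_cong simp: fun_eq_iff exponential_density_def split: split_indicator)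

text \<open>The value 0 is the cemetery state.\<close>
primrec killed_workload :: "(nat \<Rightarrow> real) \<Rightarrow> (nat \<Rightarrow> real) \<Rightarrow> real \<Rightarrow> nat \<Rightarrow> real" where
  "killed_workload I W v 0 = v"
| "killed_workload I W v (Suc n) =
    (if 0 < killed_workload I W v n \<and> I n < killed_workload I W v n
     then killed_workload I W v n - I n + W n else 0)"

lemma killed_workload_cong:
  assumes "\<And>k. k < n \<Longrightarrow> I k = I' k" "\<And>k. k < n \<Longrightarrow> W k = W' k"
  shows "killed_workload I W v n = killed_workload I' W' v n"
  using assms by (induction n) auto

lemma borel_measurable_killed_workload [measurable]:
  assumes "\<And>k. k < n \<Longrightarrow> (\<lambda>x. I x k) \<in> borel_measurable N"
    "\<And>k. k < n \<Longrightarrow> (\<lambda>x. W x k) \<in> borel_measurable N" "v \<in> borel_measurable N"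
  shows "(\<lambda>x. killed_workload (I x) (W x) (v x) n) \<in> borel_measurable N"
  using assms
proof (induction n)
  case (Suc n)
  then have [measurable]: "(\<lambda>x. killed_workload (I x) (W x) (v x) n) \<in> borel_measurable N"
    "(\<lambda>x. I x n) \<in> borel_measurable N" "(\<lambda>x. W x n) \<in> borel_measurable N"
    by simp_all
  show ?case by simp
qed simp

text \<open>All randomness sits in one independent family \<open>Z\<close>: \<open>a\<close> lists
  the arrivals, \<open>b\<close> the services, and \<open>h\<close> computes the starting workload
  from the indices in \<open>S\<close>. Independence of a step from its past is then disjointness of
  index sets, and the choice of \<open>h\<close> allows starts with or without a turn.\<close>

locale workload_chain = prob_space M for M :: "'a measure" +
  fixes Z :: "'i \<Rightarrow> 'a \<Rightarrow> real" and S :: "'i set" and a b :: "nat \<Rightarrow> 'i"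
    and h :: "('i \<Rightarrow> real) \<Rightarrow> real" and r :: real
  assumes indep: "indep_vars (\<lambda>_. borel) Z UNIV"
    and inj: "inj a" "inj b" and disj: "range a \<inter> range b = {}" "range a \<inter> S = {}" "range b \<inter> S = {}"
    and h [measurable]: "h \<in> borel_measurable (PiM S (\<lambda>_. borel))"
    and I: "\<And>n. distributed M lborel (Z (a n)) (exponential_density r)"
    and W: "\<And>n. distributed M lborel (Z (b n)) (exponential_density 1)"
    and r: "0 < r"
begin

definition V :: "nat \<Rightarrow> 'a \<Rightarrow> real" where
  "V n w = killed_workload (\<lambda>k. Z (a k) w) (\<lambda>k. Z (b k) w) (h (restrict (\<lambda>i. Z i w) S)) n"

lemma measurable_Z [measurable]: "Z i \<in> borel_measurable M"
  using indep by (simp add: indep_vars_def2)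

lemma measurable_V [measurable]: "V n \<in> borel_measurable M"
  unfolding V_def[abs_def] by measurable

lemma nn_integral_V_Suc:
  assumes [measurable]: "\<phi> \<in> borel_measurable borel"
  shows "(\<integral>\<^sup>+w. indicator {0<..} (V (Suc n) w) * \<phi> (V (Suc n) w) \<partial>M)
    = (\<integral>\<^sup>+w. indicator {0<..} (V n w) * workload_kernel r \<phi> (V n w) \<partial>M)"
proof -
  \<comment> \<open>The indices consulted by the first \<open>n\<close> steps; \<open>a n\<close>
    and \<open>b n\<close> are fresh.\<close>
  define K where "K = S \<union> a ` {..<n} \<union> b ` {..<n}"
  define g where "g f = killed_workload (\<lambda>k. f (a k)) (\<lambda>k. f (b k)) (h (restrict f S)) n" for f
  have "(\<lambda>f. restrict f S) \<in> measurable (PiM K (\<lambda>_. borel :: real measure)) (PiM S (\<lambda>_. borel))"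
    by (rule measurable_restrict_subset) (auto simp: K_def)
  then have [measurable]: "(\<lambda>f. h (restrict f S)) \<in> borel_measurable (PiM K (\<lambda>_. borel))"
    by (rule measurable_compose) simp
  have g: "g \<in> borel_measurable (PiM K (\<lambda>_. borel))"
    unfolding g_def[abs_def]
    by (intro borel_measurable_killed_workload measurable_component_singleton) (auto simp: K_def)
  have gV: "g (restrict (\<lambda>i. Z i w) K) = V n w" for w
  proof -
    have "restrict (restrict (\<lambda>i. Z i w) K) S = restrict (\<lambda>i. Z i w) S"
      by (auto simp: K_def restrict_def fun_eq_iff)
    then show ?thesis
      unfolding g_def V_def by (simp, intro killed_workload_cong) (auto simp: K_def)
  qed
  have "a n \<notin> S" "b n \<notin> S" "a i \<noteq> b j" for i j
    using disj by blast+
  then have "K \<inter> {a n, b n} = {}" "a n \<noteq> b n"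
    using inj by (auto simp: K_def inj_eq dest: not_sym)
  then have ind: "indep_var (PiM K (\<lambda>_. borel)) (\<lambda>w. restrict (\<lambda>i. Z i w) K)
      (PiM {a n, b n} (\<lambda>_. borel)) (\<lambda>w. restrict (\<lambda>i. Z i w) {a n, b n})"
    using indep by (intro indep_var_restrict[where I = UNIV]) auto
  have "indep_var (PiM {a n} (\<lambda>_. borel)) (\<lambda>w. restrict (\<lambda>i. Z i w) {a n})
      (PiM {b n} (\<lambda>_. borel)) (\<lambda>w. restrict (\<lambda>i. Z i w) {b n})"
    using indep \<open>a n \<noteq> b n\<close> by (intro indep_var_restrict[where I = UNIV]) auto
  from indep_var_compose[OF this, of "\<lambda>f. f (a n)" borel "\<lambda>f. f (b n)" borel]
  have ab: "indep_var borel (Z (a n)) borel (Z (b n))"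
    by (simp add: comp_def)
  \<comment> \<open>The indicator makes the branch in which the chain dies contribute 0, whatever
    \<open>\<phi> 0\<close> is.\<close>
  let ?\<psi> = "\<lambda>y. indicator {0<..} y * \<phi> y"
  have Suc: "V (Suc n) w = (if 0 < V n w \<and> Z (a n) w < V n w then V n w - Z (a n) w + Z (b n) w else 0)" for w
    by (simp add: V_def)
  have "(\<integral>\<^sup>+w. ?\<psi> (V (Suc n) w) \<partial>M)
    = (\<integral>\<^sup>+w. (if 0 < V n w \<and> Z (a n) w < V n w then ?\<psi> (V n w - Z (a n) w + Z (b n) w) else 0) \<partial>M)"
    by (intro nn_integral_cong) (simp add: Suc)
  also have "\<dots> = (\<integral>\<^sup>+w. indicator {0<..} (V n w) * workload_kernel r ?\<psi> (V n w) \<partial>M)"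
    unfolding gV[symmetric]
    by (rule workload_one_step[OF ind g, where \<iota> = "\<lambda>f. f (a n)" and \<upsilon> = "\<lambda>f. f (b n)"])
      (simp_all add: ab I W)
  finally show ?thesis by (simp add: workload_kernel_restrict_pos)
qed

text \<open>The factor is below 1 exactly for \<open>0 < t < 1 - r\<close>, so the bound is a
  contraction only if arrivals are slower than services.\<close>

lemma nn_integral_V_exp_le:
  assumes t: "0 \<le> t" "t < 1"
  shows "(\<integral>\<^sup>+w. indicator {0<..} (V n w) * ennreal (exp (t * V n w)) \<partial>M)
    \<le> ennreal (r / (r + t) * (1 / (1 - t))) ^ n * (\<integral>\<^sup>+w. indicator {0<..} (V 0 w) * ennreal (exp (t * V 0 w)) \<partial>M)"
proof (induction n)
  case (Suc n)
  have "(\<integral>\<^sup>+w. indicator {0<..} (V (Suc n) w) * ennreal (exp (t * V (Suc n) w)) \<partial>M)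
    = (\<integral>\<^sup>+w. indicator {0<..} (V n w) * workload_kernel r (\<lambda>y. ennreal (exp (t * y))) (V n w) \<partial>M)"
    by (rule nn_integral_V_Suc) simp
  also have "\<dots> \<le> (\<integral>\<^sup>+w. ennreal (r / (r + t) * (1 / (1 - t))) * (indicator {0<..} (V n w) * ennreal (exp (t * V n w))) \<partial>M)"
    using workload_kernel_exp[OF r t]
    by (intro nn_integral_mono) (auto split: split_indicator)
  also have "\<dots> = ennreal (r / (r + t) * (1 / (1 - t))) * (\<integral>\<^sup>+w. indicator {0<..} (V n w) * ennreal (exp (t * V n w)) \<partial>M)"
    by (rule nn_integral_cmult) simp
  also have "\<dots> \<le> ennreal (r / (r + t) * (1 / (1 - t))) * (ennreal (r / (r + t) * (1 / (1 - t))) ^ n *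
      (\<integral>\<^sup>+w. indicator {0<..} (V 0 w) * ennreal (exp (t * V 0 w)) \<partial>M))"
    using Suc by (intro mult_left_mono) auto
  finally show ?case by (simp add: mult.assoc)
qed simp

text \<open>Here \<open>k\<close> counts completed services: each of the \<open>Suc n\<close>
  arrivals costs a factor \<open>r / (1 + r)\<close>, each completed service a factor
  \<open>1 / (1 + r)\<close>. The Catalan number counts the orders of these events that start with
  one customer, end with an arrival and never empty the queue; \<open>c\<close> is the initial
  mass.\<close>

lemma nn_integral_V_catalan:
  assumes init: "\<And>\<phi>. \<phi> \<in> borel_measurable borel \<Longrightarrow>
      (\<integral>\<^sup>+w. indicator {0<..} (V 0 w) * \<phi> (V 0 w) \<partial>M) = c * (\<integral>\<^sup>+y. ennreal (exponential_density 1 y) * \<phi> y \<partial>lborel)"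
    and [measurable]: "\<phi> \<in> borel_measurable borel"
  shows "(\<integral>\<^sup>+w. indicator {0<..} (V (Suc n) w) * \<phi> (V (Suc n) w) \<partial>M)
    = c * (\<Sum>k\<le>n. ennreal (catalan_triangle n k * ((r / (1 + r)) ^ Suc n * (1 / (1 + r)) ^ k)) *
        (\<integral>\<^sup>+y. ennreal (erlang_density (Suc n - k) 1 y) * \<phi> y \<partial>lborel))"
  using \<open>\<phi> \<in> borel_measurable borel\<close>
proof (induction n arbitrary: \<phi>)
  case 0
  have [measurable]: "\<phi> \<in> borel_measurable borel" by fact
  have "(\<integral>\<^sup>+w. indicator {0<..} (V (Suc 0) w) * \<phi> (V (Suc 0) w) \<partial>M)
      = c * (\<integral>\<^sup>+y. ennreal (exponential_density 1 y) * workload_kernel r \<phi> y \<partial>lborel)"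
    by (subst nn_integral_V_Suc, simp, rule init) simp
  then show ?case
    using r by (simp add: workload_kernel_erlang)
next
  case (Suc n)
  have [measurable]: "\<phi> \<in> borel_measurable borel" by fact
  define p q where "p = r / (1 + r)" and "q = 1 / (1 + r)"
  have pq: "0 \<le> p" "0 \<le> q" using r by (auto simp: p_def q_def)
  define e where "e j = (\<integral>\<^sup>+y. ennreal (erlang_density j 1 y) * \<phi> y \<partial>lborel)" for j
  have "(\<integral>\<^sup>+w. indicator {0<..} (V (Suc (Suc n)) w) * \<phi> (V (Suc (Suc n)) w) \<partial>M)
    = c * (\<Sum>i\<le>n. ennreal (catalan_triangle n i * (p ^ Suc n * q ^ i)) *
        (\<integral>\<^sup>+y. ennreal (erlang_density (Suc n - i) 1 y) * workload_kernel r \<phi> y \<partial>lborel))"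
    unfolding p_def q_def by (subst nn_integral_V_Suc, simp, rule Suc.IH) simp
  also have "(\<Sum>i\<le>n. ennreal (catalan_triangle n i * (p ^ Suc n * q ^ i)) *
        (\<integral>\<^sup>+y. ennreal (erlang_density (Suc n - i) 1 y) * workload_kernel r \<phi> y \<partial>lborel))
    = (\<Sum>i\<le>n. \<Sum>j\<le>Suc n - i. ennreal (catalan_triangle n i * (p ^ Suc n * q ^ i)) *
        (ennreal (p * q ^ (Suc n - i - j)) * e (Suc j)))"
    unfolding p_def q_def e_def by (subst workload_kernel_erlang[OF r]) (simp_all add: sum_distrib_left)
  \<comment> \<open>\<open>k = Suc n - j\<close> is the new total of completed services:
    \<open>i\<close> earlier ones and \<open>Suc n - i - j\<close> in this step.\<close>
  also have "\<dots> = (\<Sum>i\<le>n. \<Sum>k\<in>{i..Suc n}. ennreal (catalan_triangle n i * (p ^ Suc (Suc n) * q ^ k)) * e (Suc (Suc n) - k))"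
  proof (rule sum.cong[OF refl])
    fix i assume i: "i \<in> {..n}"
    show "(\<Sum>j\<le>Suc n - i. ennreal (catalan_triangle n i * (p ^ Suc n * q ^ i)) *
        (ennreal (p * q ^ (Suc n - i - j)) * e (Suc j)))
      = (\<Sum>k\<in>{i..Suc n}. ennreal (catalan_triangle n i * (p ^ Suc (Suc n) * q ^ k)) * e (Suc (Suc n) - k))"
    proof (rule sum.reindex_bij_witness[of _ "\<lambda>k. Suc n - k" "\<lambda>j. Suc n - j"])
      fix j assume j: "j \<in> {..Suc n - i}"
      then have "q ^ (Suc n - j) = q ^ i * q ^ (Suc n - i - j)"
        using i by (simp add: power_add[symmetric])
      then have "ennreal (catalan_triangle n i * (p ^ Suc n * q ^ i)) * ennreal (p * q ^ (Suc n - i - j))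
        = ennreal (catalan_triangle n i * (p ^ Suc (Suc n) * q ^ (Suc n - j)))"
        using i pq catalan_triangle_nonneg[of i n] by (subst ennreal_mult[symmetric]) (simp_all add: mult_ac)
      then show "ennreal (catalan_triangle n i * (p ^ Suc (Suc n) * q ^ (Suc n - j))) * e (Suc (Suc n) - (Suc n - j))
        = ennreal (catalan_triangle n i * (p ^ Suc n * q ^ i)) * (ennreal (p * q ^ (Suc n - i - j)) * e (Suc j))"
        using i j by (simp add: mult.assoc[symmetric] Suc_diff_le)
    qed (use i in auto)
  qed
  also have "\<dots> = (\<Sum>i\<le>n. \<Sum>k\<le>Suc n. if i \<le> k then ennreal (catalan_triangle n i * (p ^ Suc (Suc n) * q ^ k)) * e (Suc (Suc n) - k) else 0)"
    by (intro sum.cong refl sum.mono_neutral_cong_left) auto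
  also have "\<dots> = (\<Sum>k\<le>Suc n. \<Sum>i\<le>n. if i \<le> k then ennreal (catalan_triangle n i * (p ^ Suc (Suc n) * q ^ k)) * e (Suc (Suc n) - k) else 0)"
    by (rule sum.swap)
  also have "\<dots> = (\<Sum>k\<le>Suc n. ennreal (catalan_triangle (Suc n) k * (p ^ Suc (Suc n) * q ^ k)) * e (Suc (Suc n) - k))"
  proof (rule sum.cong[OF refl])
    fix k assume k: "k \<in> {..Suc n}"
    \<comment> \<open>For \<open>k = Suc n\<close> the right side has one more term,
      \<open>i = Suc n\<close>, which is zero by the boundary value of the triangle.\<close>
    have "(\<Sum>i\<le>n. if i \<le> k then ennreal (catalan_triangle n i * (p ^ Suc (Suc n) * q ^ k)) * e (Suc (Suc n) - k) else 0)
      = (\<Sum>i\<le>k. ennreal (catalan_triangle n i * (p ^ Suc (Suc n) * q ^ k)) * e (Suc (Suc n) - k))"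
      using k by (intro sum.mono_neutral_cong) (auto simp: le_Suc_eq)
    also have "\<dots> = (\<Sum>i\<le>k. ennreal (catalan_triangle n i * (p ^ Suc (Suc n) * q ^ k))) * e (Suc (Suc n) - k)"
      by (simp add: sum_distrib_right)
    also have "(\<Sum>i\<le>k. ennreal (catalan_triangle n i * (p ^ Suc (Suc n) * q ^ k)))
      = ennreal (catalan_triangle (Suc n) k * (p ^ Suc (Suc n) * q ^ k))"
      using k pq by (subst sum_ennreal) (auto simp: catalan_triangle_sum sum_distrib_right intro!: mult_nonneg_nonneg catalan_triangle_nonneg)
    finally show "(\<Sum>i\<le>n. if i \<le> k then ennreal (catalan_triangle n i * (p ^ Suc (Suc n) * q ^ k)) * e (Suc (Suc n) - k) else 0)
      = ennreal (catalan_triangle (Suc n) k * (p ^ Suc (Suc n) * q ^ k)) * e (Suc (Suc n) - k)" .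
  qed
  finally show ?case unfolding p_def q_def e_def .
qed

end

subsection \<open>Independence\<close>

text \<open>Independence is a statement about laws, which do not see null sets. Busemann increments
  coincide with functions of the weights only almost surely, so this transfer is needed.\<close>

lemma (in prob_space) indep_var_cong_AE:
  assumes ind: "indep_var S X T Y"
    and AE: "AE w in M. X w = X' w" "AE w in M. Y w = Y' w"
    and [measurable]: "X' \<in> measurable M S" "Y' \<in> measurable M T"
  shows "indep_var S X' T Y'"
proof -
  have [measurable]: "X \<in> measurable M S" "Y \<in> measurable M T"
    and D: "distr M S X \<Otimes>\<^sub>M distr M T Y = distr M (S \<Otimes>\<^sub>M T) (\<lambda>x. (X x, Y x))"
    using ind by (auto simp: indep_var_distribution_eq)
  have "distr M S X = distr M S X'" "distr M T Y = distr M T Y'"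
    using AE by (auto intro!: distr_cong_AE)
  moreover have "distr M (S \<Otimes>\<^sub>M T) (\<lambda>x. (X x, Y x)) = distr M (S \<Otimes>\<^sub>M T) (\<lambda>x. (X' x, Y' x))"
    using AE by (intro distr_cong_AE) auto
  ultimately show ?thesis
    using D by (simp add: indep_var_distribution_eq)
qed

text \<open>A finite cylinder event splits into a part on each summand; independence between the
  families and then within each gives the product. It merges weights and increments into one family
  for the workload chain.\<close>

lemma (in prob_space) indep_vars_case_sum:
  fixes X Y :: "'i \<Rightarrow> 'a \<Rightarrow> 'b"
  assumes X: "indep_vars (\<lambda>_. N) X UNIV" and Y: "indep_vars (\<lambda>_. N) Y UNIV"
    and XY: "indep_var (PiM UNIV (\<lambda>_. N)) (\<lambda>w i. X i w) (PiM UNIV (\<lambda>_. N)) (\<lambda>w j. Y j w)"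
  shows "indep_vars (\<lambda>_. N) (case_sum X Y) UNIV"
proof -
  have [measurable]: "X i \<in> measurable M N" "Y i \<in> measurable M N" for i
    using X Y by (auto simp: indep_vars_def2)
  have prod: "prob (\<Inter>j\<in>J. Z j -` A j \<inter> space M) = (\<Prod>j\<in>J. prob (Z j -` A j \<inter> space M))"
    if "indep_vars (\<lambda>_. N) Z UNIV" "finite J" "J \<noteq> {}" "\<And>j. j \<in> J \<Longrightarrow> A j \<in> sets N"
    for Z :: "'i \<Rightarrow> 'a \<Rightarrow> 'b" and J A
    using indep_varsD[OF that(1) that(3,2)] that(4) by auto
  \<comment> \<open>The empty index set has to be included, because a finite \<open>J\<close> may
    lie entirely in one summand.\<close>
  have prod': "prob {w\<in>space M. \<forall>j\<in>J. Z j w \<in> A j} = (\<Prod>j\<in>J. prob {w\<in>space M. Z j w \<in> A j})"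
    if "indep_vars (\<lambda>_. N) Z UNIV" "finite J" "\<And>j. j \<in> J \<Longrightarrow> A j \<in> sets N"
    for Z :: "'i \<Rightarrow> 'a \<Rightarrow> 'b" and J A
  proof (cases "J = {}")
    case False
    have "{w\<in>space M. \<forall>j\<in>J. Z j w \<in> A j} = (\<Inter>j\<in>J. Z j -` A j \<inter> space M)"
      using False by auto
    then show ?thesis
      using prod[OF that(1,2) False that(3)] by (simp add: vimage_def Int_def conj_commute)
  qed (simp add: prob_space)
  show ?thesis
    unfolding indep_vars_def2
  proof (intro conjI ballI indep_setsI)
    fix k :: "'i + 'i"
    show "random_variable N (case_sum X Y k)" by (cases k) simp_all
    then show "{case_sum X Y k -` A \<inter> space M |A. A \<in> sets N} \<subseteq> events"
      by (auto intro: measurable_sets)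
  next
    fix A and J :: "('i + 'i) set"
    assume J: "J \<noteq> {}" "J \<subseteq> UNIV" "finite J" and A: "\<forall>j\<in>J. A j \<in> {case_sum X Y j -` A \<inter> space M |A. A \<in> sets N}"
    from A have "\<forall>j\<in>J. \<exists>C. A j = case_sum X Y j -` C \<inter> space M \<and> C \<in> sets N" by blast
    from bchoice[OF this] obtain C where C: "\<And>j. j \<in> J \<Longrightarrow> A j = case_sum X Y j -` C j \<inter> space M"
      "\<And>j. j \<in> J \<Longrightarrow> C j \<in> sets N" by auto
    define JX JY where "JX = Inl -` J" and "JY = Inr -` J"
    have fin: "finite JX" "finite JY"
      using J by (auto simp: JX_def JY_def intro!: finite_vimageI)
    have J_eq: "J = Inl ` JX \<union> Inr ` JY"
      by (auto simp: JX_def JY_def image_iff) (metis sum.exhaust)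
    define SX SY where "SX = {f \<in> space (PiM UNIV (\<lambda>_. N)). \<forall>i\<in>JX. f i \<in> C (Inl i)}"
      and "SY = {f \<in> space (PiM UNIV (\<lambda>_. N)). \<forall>i\<in>JY. f i \<in> C (Inr i)}"
    have C': "i \<in> JX \<Longrightarrow> C (Inl i) \<in> sets N" "i \<in> JY \<Longrightarrow> C (Inr i) \<in> sets N" for i
      using C(2) by (auto simp: JX_def JY_def)
    have [measurable]: "SX \<in> sets (PiM UNIV (\<lambda>_. N))" "SY \<in> sets (PiM UNIV (\<lambda>_. N))"
      unfolding SX_def SY_def using fin C' by measurable
    have sp: "(\<lambda>i. Z i w) \<in> space (PiM UNIV (\<lambda>_. N))" if "w \<in> space M" "\<And>i. Z i \<in> measurable M N" for Z :: "'i \<Rightarrow> 'a \<Rightarrow> 'b" and w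
      using that by (auto simp: space_PiM dest: measurable_space)
    have eqX: "(\<lambda>w i. X i w) -` SX \<inter> space M = {w\<in>space M. \<forall>j\<in>JX. X j w \<in> C (Inl j)}"
      and eqY: "(\<lambda>w i. Y i w) -` SY \<inter> space M = {w\<in>space M. \<forall>j\<in>JY. Y j w \<in> C (Inr j)}"
      by (auto simp: SX_def SY_def sp)
    have "(\<Inter>j\<in>J. A j) = (\<lambda>w. ((\<lambda>i. X i w), (\<lambda>i. Y i w))) -` (SX \<times> SY) \<inter> space M"
    proof -
      have "(\<Inter>j\<in>J. A j) = {w\<in>space M. \<forall>j\<in>J. case_sum X Y j w \<in> C j}"
        using J(1) C(1) by auto
      then show ?thesis
        by (auto simp: J_eq ball_Un SX_def SY_def sp)
    qed
    then have "prob (\<Inter>j\<in>J. A j) = prob ((\<lambda>w i. X i w) -` SX \<inter> space M) * prob ((\<lambda>w i. Y i w) -` SY \<inter> space M)"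
      using indep_varD[OF XY, of SX SY] by simp
    also have "\<dots> = (\<Prod>j\<in>JX. prob {w\<in>space M. X j w \<in> C (Inl j)}) * (\<Prod>j\<in>JY. prob {w\<in>space M. Y j w \<in> C (Inr j)})"
      unfolding eqX eqY using fin C' by (simp add: prod'[OF X] prod'[OF Y])
    also have "\<dots> = (\<Prod>j\<in>J. prob {w\<in>space M. case_sum X Y j w \<in> C j})"
      unfolding J_eq using fin by (subst prod.union_disjoint) (auto simp: prod.reindex)
    also have "\<dots> = (\<Prod>j\<in>J. prob (A j))"
      using C(1) by (intro prod.cong) (auto simp: vimage_def Int_def conj_commute)
    finally show "prob (\<Inter>j\<in>J. A j) = (\<Prod>j\<in>J. prob (A j))" .
  qed
qed

lemma (in prob_space) indep_vars_reindex_inj: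
  assumes ind: "indep_vars (\<lambda>_. N) X UNIV" and s: "inj s"
  shows "indep_vars (\<lambda>_. N) (\<lambda>k. X (s k)) UNIV"
proof (cases "UNIV = ({} :: 'b set)")
  case False
  have "indep_vars (\<lambda>k. PiM {s k} (\<lambda>_. N)) (\<lambda>k w. restrict (\<lambda>i. X i w) {s k}) UNIV"
    using s by (intro indep_vars_restrict[OF ind]) (auto simp: disjoint_family_on_def inj_eq)
  from indep_vars_compose2[OF this, of "\<lambda>k f. f (s k)" "\<lambda>_. N"]
  show ?thesis by simp
qed simp

subsection \<open>Locality of last-passage times\<close>

lemma up_right_path_bounds:
  assumes "up_right_path u v p"
  shows "fst u \<le> fst v \<and> snd u \<le> snd v \<and> set p \<subseteq> {fst u..fst v} \<times> {snd u..snd v}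
    \<and> int (length p) = fst v - fst u + snd v - snd u + 1"
  using assms
proof (induction p arbitrary: u)
  case Nil
  then show ?case by (simp add: up_right_path_def)
next
  case (Cons x p)
  show ?case
  proof (cases p)
    case Nil
    with Cons.prems show ?thesis by (auto simp: up_right_path_def mem_Times_iff)
  next
    case (Cons y q)
    with Cons.prems have x: "x = u" and p: "up_right_path y v p" and y: "y = u + e1 \<or> y = u + e2"
      by (auto simp: up_right_path_def algebra_simps)
    show ?thesis
      using Cons.IH[OF p] y x by (auto simp: subset_iff mem_Times_iff add1_zle_eq intro: less_imp_le)
  qed
qed

lemma finite_up_right_paths: "finite {p. up_right_path u v p}"
proof (rule finite_subset)
  let ?S = "{fst u..fst v} \<times> {snd u..snd v}"
  show "{p. up_right_path u v p} \<subseteq> {p. set p \<subseteq> ?S \<and> length p = nat (fst v - fst u + snd v - snd u + 1)}"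
  proof
    fix p assume "p \<in> {p. up_right_path u v p}"
    then have "up_right_path u v p" by simp
    from up_right_path_bounds[OF this]
    show "p \<in> {p. set p \<subseteq> ?S \<and> length p = nat (fst v - fst u + snd v - snd u + 1)}" by auto
  qed
  show "finite {p. set p \<subseteq> ?S \<and> length p = nat (fst v - fst u + snd v - snd u + 1)}"
    by (rule finite_lists_length_eq) simp
qed

text \<open>A path ending at \<open>v\<close> stays weakly southwest of \<open>v\<close>. If there
  is no path, both sides are the same \<open>Max {}\<close>.\<close>

lemma last_passage_cong:
  assumes "\<And>x. fst x \<le> fst v \<Longrightarrow> snd x \<le> snd v \<Longrightarrow> f x = g x"
  shows "last_passage f u v = last_passage g u v"
proof -
  have "(\<Sum>x\<leftarrow>p. f x) = (\<Sum>x\<leftarrow>p. g x)" if "up_right_path u v p" for p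
    using up_right_path_bounds[OF that] assms
    by (intro arg_cong[where f = sum_list] map_cong) (auto simp: subset_iff)
  then show ?thesis
    unfolding last_passage_def by (intro arg_cong[where f = Max]) (auto, metis)
qed

lemma borel_measurable_last_passage [measurable]:
  assumes "\<And>x. fst x \<le> fst v \<Longrightarrow> snd x \<le> snd v \<Longrightarrow> (\<lambda>s. f s x) \<in> borel_measurable N"
  shows "(\<lambda>s. last_passage (f s) u v) \<in> borel_measurable N"
proof -
  have sum: "(\<lambda>s. \<Sum>x\<leftarrow>p. f s x) \<in> borel_measurable N"
    if "\<And>x. x \<in> set p \<Longrightarrow> (\<lambda>s. f s x) \<in> borel_measurable N" for p
    using that by (induction p) auto
  have "(\<lambda>s. Max ((\<lambda>p. \<Sum>x\<leftarrow>p. f s x) ` {p. up_right_path u v p})) \<in> borel_measurable N"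
  proof (intro borel_measurable_Max finite_up_right_paths sum)
    fix p x assume p: "p \<in> {p. up_right_path u v p}" and x: "x \<in> set p"
    then have "up_right_path u v p" by simp
    from up_right_path_bounds[OF this] x
    show "(\<lambda>s. f s x) \<in> borel_measurable N" by (intro assms) auto
  qed
  then show ?thesis
    by (simp add: last_passage_def setcompr_eq_image)
qed

text \<open>Fixing one sequence turns the almost sure Busemann limit into an explicit measurable
  function of the weights.\<close>

lemma ex_sequence_in_direction:
  assumes "1 < \<rho>"
  shows "\<exists>u. sequence_in_direction (busemann_direction \<rho>) u"
proof -
  define d1 d2 where "d1 = 1 / (1 + (\<rho> - 1)\<^sup>2)" and "d2 = (\<rho> - 1)\<^sup>2 / (1 + (\<rho> - 1)\<^sup>2)"
  have d: "0 < d1" "0 \<le> d2" by (auto simp: d1_def d2_def add_pos_nonneg)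
  have dir: "busemann_direction \<rho> = (- d1, - d2)"
    by (simp add: busemann_direction_def d1_def d2_def)
  define u where "u n = (\<lfloor>- d1 * real n\<rfloor>, \<lfloor>- d2 * real n\<rfloor>)" for n :: nat
  have lim: "(\<lambda>n. real_of_int \<lfloor>c * real n\<rfloor> / real n) \<longlonglongrightarrow> c" for c
    by real_asymp
  have "filterlim (\<lambda>n. \<lfloor>d1 * real n\<rfloor>) at_top sequentially"
    using d by real_asymp
  moreover have "\<lfloor>d1 * real n\<rfloor> \<le> \<bar>fst (u n)\<bar> + \<bar>snd (u n)\<bar>" for n
    unfolding u_def by (simp, linarith)
  ultimately have "filterlim (\<lambda>n. \<bar>fst (u n)\<bar> + \<bar>snd (u n)\<bar>) at_top sequentially"
    by (auto intro: filterlim_at_top_mono)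
  moreover have "(\<lambda>n. (real_of_int (fst (u n)) / real n, real_of_int (snd (u n)) / real n)) \<longlonglongrightarrow> (- d1, - d2)"
    unfolding u_def fst_conv snd_conv by (intro tendsto_Pair lim)
  ultimately show ?thesis
    unfolding sequence_in_direction_def dir by blast
qed

subsection \<open>The queueing map\<close>

text \<open>On the reals \<open>Sup\<close> is defined as a \<open>LEAST\<close> upper bound; when
  none exists the defining predicate is constantly false, so all such sets share one value.\<close>

lemma Sup_real_unbounded:
  fixes X :: "real set"
  assumes "\<not> bdd_above X"
  shows "Sup X = Sup UNIV"
proof -
  have *: "(\<forall>x\<in>X. x \<le> z) \<longleftrightarrow> False" "(\<forall>x\<in>UNIV. x \<le> z) \<longleftrightarrow> False" for z
    using assms by (auto simp: bdd_above_def intro: gt_ex simp: not_le)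
  show ?thesis unfolding Sup_real_def * ..
qed

lemma borel_measurable_queue_sup [measurable]:
  assumes [measurable]: "\<And>k. (\<lambda>s. G s k) \<in> borel_measurable N" "\<And>k. (\<lambda>s. \<omega> s k) \<in> borel_measurable N"
  shows "(\<lambda>s. queue_sup (G s) (\<omega> s) l) \<in> borel_measurable N"
proof -
  define f where "f k s = G s k + (\<Sum>i=k..l. \<omega> s i)" for k s
  define b where "b s \<longleftrightarrow> bdd_above ((\<lambda>k. f k s) ` {..l})" for s
  have [measurable]: "f k \<in> borel_measurable N" for k
    unfolding f_def[abs_def] by measurable
  have "b s \<longleftrightarrow> (\<exists>n::nat. \<forall>k\<in>{..l}. f k s \<le> real n)" for s
    unfolding b_def bdd_above_def by (auto, meson order.trans real_arch_simple)
  then have [measurable]: "Measurable.pred N b"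
    by (simp add: b_def[abs_def] fun_eq_iff cong: measurable_cong)
  \<comment> \<open>Measurability of a countable supremum requires boundedness at every point, so
    the terms are replaced by 0 off \<open>b\<close>.\<close>
  have "(\<lambda>s. SUP k\<in>{..l}. if b s then f k s else 0) \<in> borel_measurable N"
  proof (rule borel_measurable_cSUP)
    show "(\<lambda>s. if b s then f k s else 0) \<in> borel_measurable N" for k
      by measurable
    show "bdd_above ((\<lambda>k. if b s then f k s else 0) ` {..l})" for s
      by (cases "b s") (auto simp: b_def)
  qed simp
  then have "(\<lambda>s. if b s then SUP k\<in>{..l}. if b s then f k s else 0 else Sup UNIV) \<in> borel_measurable N"
    by measurable
  also have "(\<lambda>s. if b s then SUP k\<in>{..l}. if b s then f k s else 0 else Sup UNIV) = (\<lambda>s. queue_sup (G s) (\<omega> s) l)"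
    unfolding queue_sup_def f_def[symmetric]
    by (auto simp: fun_eq_iff b_def intro!: Sup_real_unbounded[symmetric])
  finally show ?thesis .
qed

text \<open>\<open>departure\<close> selects its potential by \<open>SOME\<close>, which gives no
  control of how it depends on \<open>I\<close>. In this explicit choice each value is a finite sum,
  hence measurable in \<open>I\<close>.\<close>

definition potential :: "(int \<Rightarrow> real) \<Rightarrow> int \<Rightarrow> real" where
  "potential I k = (if 0 \<le> k then \<Sum>i=1..k. I i else - (\<Sum>i=k+1..0. I i))"

lemma potential_diff: "potential I k - potential I (k - 1) = I k"
proof -
  consider "k \<ge> 1" | "k = 0" | "k < 0" by linarith
  then show ?thesis
  proof cases
    case 1
    then have "{1..k} = insert k {1..k-1}" by auto
    then show ?thesis using 1 by (simp add: potential_def)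
  next
    case 2
    then show ?thesis by (simp add: potential_def)
  next
    case 3
    then have "{k..0} = insert k {k+1..0}" by auto
    then show ?thesis using 3 by (simp add: potential_def)
  qed
qed

lemma bdd_above_image_add:
  fixes c :: real
  shows "bdd_above ((\<lambda>x. x + c) ` X) \<longleftrightarrow> bdd_above X"
proof
  assume "bdd_above ((\<lambda>x. x + c) ` X)"
  then obtain B where "\<And>x. x \<in> X \<Longrightarrow> x + c \<le> B" by (auto simp: bdd_above_def)
  then show "bdd_above X" by (intro bdd_aboveI[where M = "B - c"]) (simp add: le_diff_eq)
next
  assume "bdd_above X"
  then obtain B where "\<And>x. x \<in> X \<Longrightarrow> x \<le> B" by (auto simp: bdd_above_def)
  then show "bdd_above ((\<lambda>x. x + c) ` X)" by (intro bdd_aboveI2[where M = "B + c"]) simp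
qed

text \<open>Where the suprema are infinite, \<open>Sup\<close> is a junk constant and both sides
  vanish. This makes the departure map measurable on the whole space, not just almost everywhere.\<close>
lemma departure_eq_potential:
  "departure I \<omega> l = queue_sup (potential I) \<omega> l - queue_sup (potential I) \<omega> (l - 1)"
proof -
  define H where "H = (SOME G. \<forall>k. I k = G k - G (k - 1))"
  define c where "c = H 0 - potential I 0"
  have H: "I k = H k - H (k - 1)" for k
    using someI_ex[OF increments_exist[of I]] unfolding H_def by blast
  have shift: "H k = potential I k + c" for k
    unfolding c_def by (rule increments_unique) (simp add: potential_diff H[symmetric])
  define F where "F G m = (\<lambda>k. G k + (\<Sum>i=k..m. \<omega> i)) ` {..m}" for G m
  \<comment> \<open>The two suprema are finite together or infinite together. So either both shift
    by \<open>c\<close> or both keep their default value, and the difference agrees in each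
    case.\<close>
  have bdd: "bdd_above (F (potential I) l) \<longleftrightarrow> bdd_above (F (potential I) (l - 1))"
  proof -
    have "{..l} = insert l {..l-1}" by auto
    moreover have "(\<Sum>i=k..l. \<omega> i) = (\<Sum>i=k..l-1. \<omega> i) + \<omega> l" if "k \<le> l - 1" for k
    proof -
      have "{k..l} = insert l {k..l-1}" using that by auto
      then show ?thesis by simp
    qed
    ultimately have F_eq: "F (potential I) l = insert (potential I l + \<omega> l) ((\<lambda>x. x + \<omega> l) ` F (potential I) (l - 1))"
      by (auto simp: F_def image_image add.assoc)
    show ?thesis unfolding F_eq by (simp add: bdd_above_image_add)
  qed
  have Sup_shift: "queue_sup H \<omega> m = c + queue_sup (potential I) \<omega> m" if "bdd_above (F (potential I) m)" for m
  proof -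
    have "queue_sup H \<omega> m = (SUP k\<in>{..m}. c + (potential I k + (\<Sum>i=k..m. \<omega> i)))"
      by (simp add: queue_sup_def shift algebra_simps)
    also have "\<dots> = c + (SUP k\<in>{..m}. potential I k + (\<Sum>i=k..m. \<omega> i))"
      using that by (intro Sup_add_eq) (auto simp: F_def)
    finally show ?thesis by (simp add: queue_sup_def)
  qed
  have Sup_const: "queue_sup H \<omega> m = queue_sup (potential I) \<omega> m" if "\<not> bdd_above (F (potential I) m)" for m
  proof -
    have "F H m = (\<lambda>x. x + c) ` F (potential I) m"
      by (auto simp: F_def image_image shift algebra_simps)
    then have "\<not> bdd_above (F H m)"
      using that by (simp add: bdd_above_image_add)
    then have "Sup (F H m) = Sup (F (potential I) m)"
      using that Sup_real_unbounded[of "F H m"] Sup_real_unbounded[of "F (potential I) m"] by simp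
    then show ?thesis
      by (simp add: queue_sup_def F_def)
  qed
  have "queue_sup H \<omega> l - queue_sup H \<omega> (l - 1)
    = queue_sup (potential I) \<omega> l - queue_sup (potential I) \<omega> (l - 1)"
    using bdd Sup_shift Sup_const by (cases "bdd_above (F (potential I) l)") simp_all
  then show ?thesis unfolding departure_def Let_def H_def .
qed

lemma borel_measurable_departure [measurable]:
  assumes [measurable]: "\<And>k. (\<lambda>s. I s k) \<in> borel_measurable N" "\<And>k. (\<lambda>s. \<omega> s k) \<in> borel_measurable N"
  shows "(\<lambda>s. departure (I s) (\<omega> s) l) \<in> borel_measurable N"
proof -
  have [measurable]: "(\<lambda>s. potential (I s) k) \<in> borel_measurable N" for k
    unfolding potential_def[abs_def] by (cases "0 \<le> k") simp_all
  show ?thesis unfolding departure_eq_potential by measurable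
qed

text \<open>Any solution of the queueing recursion is bounded below by the supremum, with equality once
  the recursion has been restarted at some time in the past.\<close>
lemma departure_eqI:
  fixes I \<omega> D J :: "int \<Rightarrow> real"
  assumes cocycle: "\<And>k. D k - J k = I k - J (k - 1)" and min: "\<And>k. \<omega> k = min (D k) (J k)"
    and turn: "\<And>l. \<exists>m\<le>l. J m \<le> D m"
  shows "departure I \<omega> l = D l"
proof -
  define G where "G = potential I"
  \<comment> \<open>With \<open>G k\<close> as arrival time and \<open>J k\<close> as sojourn time,
    \<open>L k\<close> is the departure time of customer \<open>k\<close>. Its recursion is service
    after the later of arrival and previous departure, and \<open>D\<close> is its sequence of
    increments.\<close>
  define L where "L k = G k + J k" for k
  have G: "G k = G (k - 1) + I k" for k
    using potential_diff[of I k] by (simp add: G_def)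
  have L: "L k = \<omega> k + max (G k) (L (k - 1))" for k
    using cocycle[of k] min[of k] G[of k] by (auto simp: L_def min_def max_def split: if_splits)
  have sum_Suc: "(\<Sum>i=k..m. \<omega> i) = (\<Sum>i=k..m-1. \<omega> i) + \<omega> m" if "k \<le> m" for k m
  proof -
    have "{k..m} = insert m {k..m-1}" using that by auto
    then show ?thesis by simp
  qed
  have le: "G k + (\<Sum>i=k..m. \<omega> i) \<le> L m" if "k \<le> m" for k m
    using that
  proof (induction m rule: int_ge_induct)
    case base
    show ?case using L[of k] by simp
  next
    case (step i)
    then show ?case using L[of "i + 1"] sum_Suc[of k "i + 1"] by simp
  qed
  have attained: "\<exists>k\<le>m. L m = G k + (\<Sum>i=k..m. \<omega> i)" for m
  proof -
    obtain n where n: "n \<le> m" "J n \<le> D n" using turn by blast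
    \<comment> \<open>Customer \<open>n\<close> finds an empty queue, so its sojourn time is its own
      service time and the recursion restarts.\<close>
    have "L n = G n + \<omega> n"
      using n cocycle[of n] min[of n] by (simp add: L_def min_def)
    with n(1) show ?thesis
    proof (induction m rule: int_ge_induct)
      case base
      then show ?case by (intro exI[of _ n]) simp
    next
      case (step i)
      then obtain k where k: "k \<le> i" "L i = G k + (\<Sum>j=k..i. \<omega> j)" by blast
      show ?case
      proof (cases "G (i + 1) \<le> L i")
        case True
        then show ?thesis
          using k L[of "i + 1"] sum_Suc[of k "i + 1"] by (intro exI[of _ k]) simp
      next
        case False
        then show ?thesis
          using L[of "i + 1"] by (intro exI[of _ "i + 1"]) simp
      qed
    qed
  qed
  have "queue_sup G \<omega> m = L m" for m
  proof -
    obtain k where k: "k \<le> m" "L m = G k + (\<Sum>i=k..m. \<omega> i)" using attained by blast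
    show ?thesis
      unfolding queue_sup_def
    proof (rule cSup_eq_maximum)
      show "L m \<in> (\<lambda>k. G k + (\<Sum>i=k..m. \<omega> i)) ` {..m}"
        using k by (intro image_eqI[of _ _ k]) auto
    qed (use le in auto)
  qed
  then show ?thesis
    using cocycle[of l] G[of l] by (simp add: departure_eq_potential G_def[symmetric] L_def)
qed

subsection \<open>Exponential variables\<close>

lemma distr_distributed_borel:
  fixes X :: "'a \<Rightarrow> real"
  assumes "distributed M lborel X f"
  shows "distr M borel X = density lborel f"
  using distributed_distr_eq_density[OF assms] by (simp cong: distr_cong)

lemma (in prob_space) iid_exponential_law:
  assumes "iid_exponential M r X"
  shows "distr M (PiM UNIV (\<lambda>_. borel)) (\<lambda>s k. X k s)
    = PiM UNIV (\<lambda>_. density lborel (exponential_density r))"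
proof -
  have X: "indep_vars (\<lambda>_. borel) X UNIV"
    and D: "\<And>i. distr M borel (X i) = density lborel (exponential_density r)"
    using assms by (auto simp: iid_exponential_def intro: distr_distributed_borel)
  have [measurable]: "X i \<in> borel_measurable M" for i
    using X by (simp add: indep_vars_def2)
  have "distr M (PiM UNIV (\<lambda>_. borel)) (\<lambda>x. \<lambda>i\<in>UNIV. X i x) = PiM UNIV (\<lambda>i. distr M borel (X i))"
    using indep_vars_iff_distr_eq_PiM[of UNIV X "\<lambda>_. borel"] X by simp
  then show ?thesis by (simp add: D restrict_def)
qed

lemma (in prob_space) AE_exponential_pos:
  assumes "distributed M lborel X (exponential_density l)" "0 < l"
  shows "AE w in M. 0 < X w"
proof -
  have [measurable]: "X \<in> borel_measurable M"
    using distributed_measurable[OF assms(1)] by simp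
  have "prob {w \<in> space M. 0 < X w} = 1"
    using exponential_distributedD_gt[OF assms(1) _ assms(2), of 0] by simp
  then show ?thesis
    by (subst (asm) prob_eq_1) auto
qed

context prob_space begin

text \<open>On the event that \<open>X\<close> wins, it is the minimum, which has rate
  \<open>l + m\<close> and is independent of the winner. The condition \<open>0 < X w\<close>
  matches the survival indicator of the killed chain.\<close>

lemma indep_exponential_competition:
  assumes ind: "indep_var borel X borel Y"
    and X: "distributed M lborel X (exponential_density l)"
    and Y: "distributed M lborel Y (exponential_density m)"
    and l: "0 < l" and m: "0 < m"
  shows "AE w in M. X w \<noteq> Y w"
    and "\<phi> \<in> borel_measurable borel \<Longrightarrow> (\<integral>\<^sup>+w. (if X w \<le> Y w \<and> 0 < X w then \<phi> (X w) else 0) \<partial>M)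
      = ennreal (l / (l + m)) * (\<integral>\<^sup>+x. ennreal (exponential_density (l + m) x) * \<phi> x \<partial>lborel)"
proof -
  have [measurable]: "X \<in> borel_measurable M" "Y \<in> borel_measurable M"
    using distributed_measurable[OF X] distributed_measurable[OF Y] by simp_all
  have eq [measurable]: "Measurable.pred (borel \<Otimes>\<^sub>M borel) (\<lambda>x :: real \<times> real. fst x = snd x)"
    by measurable
  have "(\<integral>\<^sup>+w. (\<lambda>z. indicator {z. fst z = snd z} z) (X w, Y w) \<partial>M)
    = (\<integral>\<^sup>+w. \<integral>\<^sup>+w'. (\<lambda>z. indicator {z. fst z = snd z} z) (X w, Y w') \<partial>M \<partial>M)"
    using ind by (rule nn_integral_indep_pair) measurable
  also have "\<dots> = (\<integral>\<^sup>+w. \<integral>\<^sup>+w'. indicator {X w} (Y w') \<partial>M \<partial>M)"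
    by (intro nn_integral_cong) (auto split: split_indicator)
  also have "\<dots> = 0"
  proof -
    have "(\<integral>\<^sup>+w'. indicator {x} (Y w') \<partial>M) = (\<integral>\<^sup>+y. ennreal (exponential_density m y) * indicator {x} y \<partial>lborel)" for x
      by (rule distributed_nn_integral[OF Y, symmetric]) simp
    also have "\<dots> x = 0" for x
      by (simp add: nn_integral_0_iff_AE)
    finally show ?thesis by simp
  qed
  finally have "AE w in M. indicator {z :: real \<times> real. fst z = snd z} (X w, Y w) = (0 :: ennreal)"
    by (subst (asm) nn_integral_0_iff_AE) simp_all
  then show "AE w in M. X w \<noteq> Y w"
    by eventually_elim (auto split: split_indicator_asm)
next
  assume [measurable]: "\<phi> \<in> borel_measurable borel"
  have [measurable]: "X \<in> borel_measurable M" "Y \<in> borel_measurable M"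
    using distributed_measurable[OF X] distributed_measurable[OF Y] by simp_all
  have tail: "(\<integral>\<^sup>+w'. indicator {x..} (Y w') \<partial>M) = ennreal (exp (- m * x))" if "0 \<le> x" for x
  proof -
    have "(\<integral>\<^sup>+w'. indicator {x..} (Y w') \<partial>M) = (\<integral>\<^sup>+y. ennreal (exponential_density m y) * indicator {x..} y \<partial>lborel)"
      by (rule distributed_nn_integral[OF Y, symmetric]) simp
    also have "\<dots> = (\<integral>\<^sup>+y. ennreal (exponential_density m y) * indicator {x<..} y \<partial>lborel)"
      by (rule nn_integral_cong_AE, rule AE_mp[OF AE_lborel_singleton[of x]]) (auto split: split_indicator)
    also have "\<dots> = ennreal (exp (- m * x))"
      using m that by (simp add: nn_integral_erlang_tail)
    finally show ?thesis .
  qed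
  define f where "f z = (if fst z \<le> snd z \<and> 0 < fst z then \<phi> (fst z) else 0)" for z :: "real \<times> real"
  have f: "f \<in> borel_measurable (borel \<Otimes>\<^sub>M borel)"
    unfolding f_def[abs_def] by measurable
  have "(\<integral>\<^sup>+w. (if X w \<le> Y w \<and> 0 < X w then \<phi> (X w) else 0) \<partial>M) = (\<integral>\<^sup>+w. f (X w, Y w) \<partial>M)"
    by (simp only: f_def fst_conv snd_conv)
  also have "\<dots> = (\<integral>\<^sup>+w. \<integral>\<^sup>+w'. f (X w, Y w') \<partial>M \<partial>M)"
    using ind f by (rule nn_integral_indep_pair)
  also have "\<dots> = (\<integral>\<^sup>+w. \<integral>\<^sup>+w'. (if 0 < X w then \<phi> (X w) else 0) * indicator {X w..} (Y w') \<partial>M \<partial>M)"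
    by (intro nn_integral_cong) (auto simp: f_def split: split_indicator)
  also have "\<dots> = (\<integral>\<^sup>+w. (if 0 < X w then \<phi> (X w) * ennreal (exp (- m * X w)) else 0) \<partial>M)"
    by (intro nn_integral_cong) (simp add: nn_integral_cmult tail)
  also have "\<dots> = (\<integral>\<^sup>+x. ennreal (exponential_density l x) * (if 0 < x then \<phi> x * ennreal (exp (- m * x)) else 0) \<partial>lborel)"
    by (rule distributed_nn_integral[OF X, symmetric]) measurable
  also have "\<dots> = (\<integral>\<^sup>+x. ennreal (l / (l + m)) * (ennreal (exponential_density (l + m) x) * \<phi> x) \<partial>lborel)"
  proof (rule nn_integral_cong_AE, rule AE_mp[OF AE_lborel_singleton[of 0]], intro AE_I2 impI)
    fix x :: real assume "x \<noteq> 0"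
    then consider "x < 0" | "0 < x" by linarith
    then show "ennreal (exponential_density l x) * (if 0 < x then \<phi> x * ennreal (exp (- m * x)) else 0)
      = ennreal (l / (l + m)) * (ennreal (exponential_density (l + m) x) * \<phi> x)"
    proof cases
      case 2
      have "l / (l + m) * exponential_density (l + m) x = exponential_density l x * exp (- m * x)"
        using 2 l m by (simp add: exponential_density_def mult.assoc exp_add[symmetric]) (simp add: algebra_simps)
      then have "ennreal (l / (l + m)) * ennreal (exponential_density (l + m) x) = ennreal (exponential_density l x) * ennreal (exp (- m * x))"
        using l m by (simp add: ennreal_mult[symmetric])
      then show ?thesis
        using 2 by (simp flip: mult.assoc) (simp add: mult.assoc mult.commute[of "\<phi> x"])
    qed (simp add: exponential_density_def)
  qed
  also have "\<dots> = ennreal (l / (l + m)) * (\<integral>\<^sup>+x. ennreal (exponential_density (l + m) x) * \<phi> x \<partial>lborel)"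
    by (rule nn_integral_cmult) simp
  finally show "(\<integral>\<^sup>+w. (if X w \<le> Y w \<and> 0 < X w then \<phi> (X w) else 0) \<partial>M)
      = ennreal (l / (l + m)) * (\<integral>\<^sup>+x. ennreal (exponential_density (l + m) x) * \<phi> x \<partial>lborel)" .
qed

end

text \<open>While every arrival finds work left, the maximum in the recursion is its second argument
  and both recursions agree. Positivity of \<open>J\<close> keeps live states apart from the
  cemetery 0.\<close>

lemma killed_workload_eq:
  assumes "\<And>k. 0 < J k" "\<And>k. J (Suc k) = W k + max 0 (J k - I k)"
  shows "killed_workload I W (if c then J 0 else 0) n = (if c \<and> (\<forall>k<n. I k < J k) then J n else 0)"
  using assms by (induction n) (auto simp: less_Suc_eq max_def)

subsection \<open>Busemann increments\<close>

definition southwest_closed :: "(int \<times> int) set \<Rightarrow> bool" where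
  "southwest_closed R \<longleftrightarrow> (\<forall>y\<in>R. \<forall>x. fst x \<le> fst y \<and> snd x \<le> snd y \<longrightarrow> x \<in> R)"

context busemann_process begin

definition hinc :: "real \<Rightarrow> int \<times> int \<Rightarrow> 'a \<Rightarrow> real" where
  "hinc \<rho> x = B \<rho> (x - e1) x"

definition vinc :: "real \<Rightarrow> int \<times> int \<Rightarrow> 'a \<Rightarrow> real" where
  "vinc \<rho> x = B \<rho> (x - e2) x"

lemma measurable_Y [measurable]: "Y x \<in> borel_measurable M"
  using weights unfolding iid_exponential_def indep_vars_def2 by blast

lemma measurable_B:
  assumes "1 < \<rho>"
  shows "B \<rho> x y \<in> borel_measurable M"
proof -
  obtain \<Phi> where [measurable]: "\<Phi> \<in> borel_measurable (PiM UNIV (\<lambda>_. borel))"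
    and "\<And>w. w \<in> space M \<Longrightarrow> B \<rho> x y w = \<Phi> (\<lambda>z. Y z w)"
    using function_of_weights[OF assms, of x y] by blast
  moreover have "(\<lambda>w z. Y z w) \<in> measurable M (PiM UNIV (\<lambda>_. borel))"
    by (rule measurable_PiM_single') auto
  ultimately show ?thesis
    by (simp cong: measurable_cong)
qed

lemma measurable_hinc: "1 < \<rho> \<Longrightarrow> hinc \<rho> x \<in> borel_measurable M"
  and measurable_vinc: "1 < \<rho> \<Longrightarrow> vinc \<rho> x \<in> borel_measurable M"
  by (simp_all add: hinc_def vinc_def measurable_B)

text \<open>Busemann increments are limits of passage-time differences, which only see weights
  weakly southwest of the two sites.\<close>
lemma increment_function_of_region:
  assumes \<rho>: "1 < \<rho>"
    and R: "southwest_closed R"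
    and xy: "x \<in> R" "y \<in> R"
  shows "\<exists>g \<in> borel_measurable (PiM R (\<lambda>_. borel)). AE w in M. B \<rho> x y w = g (restrict (\<lambda>z. Y z w) R)"
proof -
  obtain u where u: "sequence_in_direction (busemann_direction \<rho>) u"
    using ex_sequence_in_direction[OF \<rho>] by blast
  define g where "g f = lim (\<lambda>n. last_passage f (u n) y - last_passage f (u n) x)" for f
  have "(\<lambda>f. last_passage f v z) \<in> borel_measurable (PiM R (\<lambda>_. borel))" if "z \<in> R" for v z
    using that R by (intro borel_measurable_last_passage measurable_component_singleton) (auto simp: southwest_closed_def)
  then have "g \<in> borel_measurable (PiM R (\<lambda>_. borel))"
    unfolding g_def[abs_def] using xy by (intro borel_measurable_lim_metric borel_measurable_diff)
  moreover have "AE w in M. B \<rho> x y w = g (restrict (\<lambda>z. Y z w) R)"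
    using busemann_limit[OF \<rho>]
  proof eventually_elim
    case (elim w)
    have "last_passage (restrict (\<lambda>z. Y z w) R) v z = last_passage (\<lambda>z. Y z w) v z" if "z \<in> R" for v z
      using R that by (intro last_passage_cong) (auto simp: southwest_closed_def)
    moreover have "(\<lambda>n. last_passage (\<lambda>z. Y z w) (u n) y - last_passage (\<lambda>z. Y z w) (u n) x) \<longlonglongrightarrow> B \<rho> x y w"
      using elim u by blast
    ultimately show ?case
      using xy by (simp add: g_def limI)
  qed
  ultimately show ?thesis by blast
qed

text \<open>The increments are almost surely functions of the weights in \<open>R\<close>, whereas
  the sites \<open>s k\<close> lie outside \<open>R\<close>; independence is inherited from that of
  the weights.\<close>

lemma indep_weights_increments:
  assumes \<rho>: "1 < \<rho>"
    and R: "southwest_closed R"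
    and y: "range y \<subseteq> R" and s: "range s \<inter> R = {}"
  shows "indep_var (PiM UNIV (\<lambda>_. borel)) (\<lambda>w k. Y (s k) w)
    (PiM (UNIV :: int set) (\<lambda>_. borel)) (\<lambda>w k. B \<rho> (y k) (y (k + 1)) w)"
proof -
  have "\<forall>k. \<exists>g. g \<in> borel_measurable (PiM R (\<lambda>_. borel)) \<and> (AE w in M. B \<rho> (y k) (y (k + 1)) w = g (restrict (\<lambda>z. Y z w) R))"
  proof
    fix k
    have "y k \<in> R" "y (k + 1) \<in> R" using y by auto
    from increment_function_of_region[OF \<rho> R this]
    show "\<exists>g. g \<in> borel_measurable (PiM R (\<lambda>_. borel)) \<and> (AE w in M. B \<rho> (y k) (y (k + 1)) w = g (restrict (\<lambda>z. Y z w) R))"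
      unfolding Bex_def .
  qed
  from choice[OF this] obtain g where [measurable]: "\<And>k. g k \<in> borel_measurable (PiM R (\<lambda>_. borel))"
    and g: "\<And>k. AE w in M. B \<rho> (y k) (y (k + 1)) w = g k (restrict (\<lambda>z. Y z w) R)"
    by blast
  have "indep_vars (\<lambda>_. borel) Y UNIV"
    using weights by (simp add: iid_exponential_def)
  then have "indep_var (PiM (-R) (\<lambda>_. borel)) (\<lambda>w. restrict (\<lambda>z. Y z w) (-R))
      (PiM R (\<lambda>_. borel)) (\<lambda>w. restrict (\<lambda>z. Y z w) R)"
    by (rule indep_var_restrict) auto
  moreover have "(\<lambda>f k. f (s k)) \<in> measurable (PiM (-R) (\<lambda>_. borel)) (PiM UNIV (\<lambda>_. borel :: real measure))"
    using s by (intro measurable_PiM_single' measurable_component_singleton) auto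
  moreover have "(\<lambda>f k. g k f) \<in> measurable (PiM R (\<lambda>_. borel)) (PiM UNIV (\<lambda>_. borel))"
    by (intro measurable_PiM_single') auto
  ultimately have ind: "indep_var (PiM UNIV (\<lambda>_. borel)) ((\<lambda>f k. f (s k)) \<circ> (\<lambda>w. restrict (\<lambda>z. Y z w) (-R)))
      (PiM UNIV (\<lambda>_. borel)) ((\<lambda>f k. g k f) \<circ> (\<lambda>w. restrict (\<lambda>z. Y z w) R))"
    by (rule indep_var_compose)
  have "AE w in M. \<forall>k. B \<rho> (y k) (y (k + 1)) w = g k (restrict (\<lambda>z. Y z w) R)"
    using g by (simp add: AE_all_countable)
  then have "AE w in M. ((\<lambda>f k. g k f) \<circ> (\<lambda>w. restrict (\<lambda>z. Y z w) R)) w = (\<lambda>k. B \<rho> (y k) (y (k + 1)) w)"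
    by eventually_elim (auto simp: fun_eq_iff)
  moreover have "((\<lambda>f k. f (s k)) \<circ> (\<lambda>w. restrict (\<lambda>z. Y z w) (-R))) w = (\<lambda>k. Y (s k) w)" for w
    using s by (auto simp: fun_eq_iff)
  moreover have "(\<lambda>w k. Y (s k) w) \<in> measurable M (PiM UNIV (\<lambda>_. borel))"
    "(\<lambda>w k. B \<rho> (y k) (y (k + 1)) w) \<in> measurable M (PiM UNIV (\<lambda>_. borel))"
    by (auto intro!: measurable_PiM_single' measurable_B[OF \<rho>])
  ultimately show ?thesis
    by (intro indep_var_cong_AE[OF ind]) simp_all
qed

lemma AE_cocycle:
  assumes \<rho>: "1 < \<rho>"
  shows "AE w in M. \<forall>x y z. B \<rho> x y w + B \<rho> y z w = B \<rho> x z w"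
  using pathwise
proof eventually_elim
  case (elim w)
  \<comment> \<open>\<open>pathwise\<close> speaks of pairs of parameters; the midpoint of 1 and
    \<open>\<rho>\<close> serves as the smaller one.\<close>
  have "1 < (1 + \<rho>) / 2" "(1 + \<rho>) / 2 < \<rho>" using \<rho> by simp_all
  with elim show ?case by blast
qed

lemma AE_weight_eq_min:
  assumes \<rho>: "1 < \<rho>"
  shows "AE w in M. \<forall>x. Y x w = min (hinc \<rho> x w) (vinc \<rho> x w)"
  using pathwise
proof eventually_elim
  case (elim w)
  have "1 < (1 + \<rho>) / 2" "(1 + \<rho>) / 2 < \<rho>" using \<rho> by simp_all
  with elim show ?case unfolding hinc_def vinc_def by blast
qed

text \<open>Additivity along the two routes from \<open>x - e1 - e2\<close> to \<open>x\<close>. In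
  queueing terms it is the conservation law linking arrivals, departures and sojourn times.\<close>

lemma AE_square:
  assumes \<rho>: "1 < \<rho>"
  shows "AE w in M. \<forall>x. hinc \<rho> x w - vinc \<rho> x w = hinc \<rho> (x - e2) w - vinc \<rho> (x - e1) w"
  using AE_cocycle[OF \<rho>]
proof eventually_elim
  case (elim w)
  show ?case
  proof
    fix x :: "int \<times> int"
    show "hinc \<rho> x w - vinc \<rho> x w = hinc \<rho> (x - e2) w - vinc \<rho> (x - e1) w"
      using elim[rule_format, of "x - e1 - e2" "x - e1" x] elim[rule_format, of "x - e1 - e2" "x - e2" x]
      by (cases x) (simp add: hinc_def vinc_def)
  qed
qed

lemma AE_B_swap:
  assumes \<rho>: "1 < \<rho>"
  shows "AE w in M. B \<rho> x y w = - B \<rho> y x w"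
  using AE_cocycle[OF \<rho>]
proof eventually_elim
  case (elim w)
  show ?case using elim[rule_format, of x x x] elim[rule_format, of x y x] by simp
qed

lemma AE_vinc_pos:
  assumes \<rho>: "1 < \<rho>"
  shows "AE w in M. \<forall>x. 0 < vinc \<rho> x w"
proof -
  have "AE w in M. 0 < vinc \<rho> x w" for x
    unfolding vinc_def using \<rho> by (intro AE_exponential_pos[OF vertical]) auto
  then show ?thesis by (simp add: AE_all_countable)
qed

lemma indep_vinc_hinc:
  assumes \<rho>: "1 < \<rho>"
  shows "indep_var borel (vinc \<rho> x) borel (hinc \<rho> x)"
proof -
  \<comment> \<open>The path enters \<open>x\<close> from the west and leaves it downwards, so its
    steps at \<open>-1\<close> and \<open>0\<close> are the two edges at \<open>x\<close>; the
    vertical one is traversed backwards, hence the sign below.\<close>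
  define y where "y k = x + (if k \<le> 0 then (k, 0) else (k - 1, -1))" for k :: int
  have "down_right_path y"
    by (auto simp: down_right_path_def y_def)
  from down_right_independent[OF \<rho> this]
  have "indep_var (PiM {0} (\<lambda>_. borel)) (\<lambda>w. restrict (\<lambda>k. B \<rho> (y k) (y (k + 1)) w) {0})
    (PiM {-1} (\<lambda>_. borel)) (\<lambda>w. restrict (\<lambda>k. B \<rho> (y k) (y (k + 1)) w) {-1})"
    by (rule indep_var_restrict) auto
  from indep_var_compose[OF this, of "\<lambda>f. - f 0" borel "\<lambda>f. f (-1)" borel]
  have *: "indep_var borel (\<lambda>w. - B \<rho> x (x - e2) w) borel (hinc \<rho> x)"
    by (cases x) (simp add: comp_def y_def hinc_def[abs_def])
  have swap: "AE w in M. - B \<rho> x (x - e2) w = vinc \<rho> x w"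
    using AE_B_swap[OF \<rho>, of "x - e2" x] by (auto simp: vinc_def)
  from indep_var_cong_AE[OF * swap AE_I2] show ?thesis
    using measurable_hinc[OF \<rho>] measurable_vinc[OF \<rho>] by simp
qed

subsection \<open>Runs of the geodesic as busy periods\<close>

definition site :: "int \<times> int \<Rightarrow> int \<Rightarrow> int \<times> int" where
  "site z k = z + (if 0 \<le> k then (k + 1, 0) else (1, - k))"

definition corner_path :: "int \<times> int \<Rightarrow> int \<Rightarrow> int \<times> int" where
  "corner_path z k = z + (if k \<le> 0 then (k, 0) else (k - 1, - 1))"

text \<open>The right summand lists the increments along the path that comes in along the row of \<open>z\<close>, steps
  down at \<open>z\<close> and continues on the row below; the left summand lists weights outside the region
  seen by that path. Only the sites \<open>z + (k + 1, 0)\<close>, \<open>k \<ge> 0\<close>, matter; the others fill up the index type.\<close>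
definition corner_family :: "real \<Rightarrow> int \<times> int \<Rightarrow> int + int \<Rightarrow> 'a \<Rightarrow> real" where
  "corner_family \<rho> z = case_sum (\<lambda>k. Y (site z k)) (\<lambda>k. B \<rho> (corner_path z k) (corner_path z (k + 1)))"

lemma corner_family_simps:
  "corner_family \<rho> z (Inl (int n)) = Y (z + (int n + 1, 0))"
  "corner_family \<rho> z (Inr (int n + 1)) = hinc \<rho> (z + (int n + 1, - 1))"
  "corner_family \<rho> z (Inr (- 1)) = hinc \<rho> z"
  "corner_family \<rho> z (Inr 0) = B \<rho> z (z - e2)"
proof -
  obtain a b where z: "z = (a, b)" by fastforce
  show "corner_family \<rho> z (Inl (int n)) = Y (z + (int n + 1, 0))"
    "corner_family \<rho> z (Inr (int n + 1)) = hinc \<rho> (z + (int n + 1, - 1))"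
    "corner_family \<rho> z (Inr (- 1)) = hinc \<rho> z"
    "corner_family \<rho> z (Inr 0) = B \<rho> z (z - e2)"
    unfolding z by (simp_all add: corner_family_def site_def corner_path_def hinc_def add.commute)
qed

lemma indep_corner_family:
  assumes \<rho>: "1 < \<rho>"
  shows "indep_vars (\<lambda>_. borel) (corner_family \<rho> z) UNIV"
  unfolding corner_family_def
proof (rule indep_vars_case_sum)
  have inj: "inj (site z)"
    by (rule injI) (auto simp: site_def split: if_splits)
  have "indep_vars (\<lambda>_. borel) Y UNIV"
    using weights by (simp add: iid_exponential_def)
  from indep_vars_reindex_inj[OF this inj]
  show "indep_vars (\<lambda>_. borel) (\<lambda>k. Y (site z k)) UNIV" .
  have "down_right_path (corner_path z)"
    by (auto simp: down_right_path_def corner_path_def)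
  then show "indep_vars (\<lambda>_. borel) (\<lambda>k. B \<rho> (corner_path z k) (corner_path z (k + 1))) UNIV"
    by (rule down_right_independent[OF \<rho>])
  show "indep_var (PiM UNIV (\<lambda>_. borel)) (\<lambda>w k. Y (site z k) w)
    (PiM UNIV (\<lambda>_. borel)) (\<lambda>w k. B \<rho> (corner_path z k) (corner_path z (k + 1)) w)"
  proof (rule indep_weights_increments[OF \<rho>])
    \<comment> \<open>All columns up to that of \<open>z\<close> and all rows below it: this
      contains both legs of the corner path, while every \<open>site\<close> lies further east in a
      row not below \<open>z\<close>.\<close>
    show "southwest_closed {x. fst x \<le> fst z \<or> snd x < snd z}"
      by (auto simp: southwest_closed_def)
    show "range (corner_path z) \<subseteq> {x. fst x \<le> fst z \<or> snd x < snd z}"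
      by (cases z) (simp add: corner_path_def image_subset_iff)
    have "site z k \<notin> {x. fst x \<le> fst z \<or> snd x < snd z}" for k
      by (cases z) (simp add: site_def)
    then show "range (site z) \<inter> {x. fst x \<le> fst z \<or> snd x < snd z} = {}"
      by blast
  qed
qed

lemma workload_chain_corner:
  assumes \<rho>: "1 < \<rho>" and h: "h \<in> borel_measurable (PiM {Inr (- 1), Inr 0} (\<lambda>_. borel))"
  shows "workload_chain M (corner_family \<rho> z) {Inr (- 1), Inr 0}
    (\<lambda>n. Inr (int n + 1)) (\<lambda>n. Inl (int n)) h (1 / \<rho>)"
proof unfold_locales
  show "indep_vars (\<lambda>_. borel) (corner_family \<rho> z) UNIV"
    using \<rho> by (rule indep_corner_family)
  show "distributed M lborel (corner_family \<rho> z (Inr (int n + 1))) (exponential_density (1 / \<rho>))" for n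
    unfolding corner_family_simps hinc_def by (rule horizontal[OF \<rho>])
  show "distributed M lborel (corner_family \<rho> z (Inl (int n))) (exponential_density 1)" for n
    unfolding corner_family_simps using weights by (simp only: iid_exponential_def)
  show "0 < 1 / \<rho>" using \<rho> by simp
  show "h \<in> borel_measurable (PiM {Inr (- 1), Inr 0} (\<lambda>_. borel))" by (rule h)
  show "inj (\<lambda>n. Inr (int n + 1))" "inj (\<lambda>n. Inl (int n))"
    by (simp_all add: inj_def)
  show "range (\<lambda>n. Inr (int n + 1)) \<inter> range (\<lambda>n. Inl (int n)) = {}"
    "range (\<lambda>n. Inr (int n + 1)) \<inter> {Inr (- 1), Inr 0} = {}"
    "range (\<lambda>n. Inl (int n)) \<inter> {Inr (- 1), Inr 0} = {}"
    by auto
qed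

text \<open>The quantifier over \<open>c\<close> stands inside the almost sure statement, so that
  \<open>c\<close> may depend on \<open>w\<close>: \<open>True\<close> for the decay of long runs,
  the turn at \<open>z\<close> for the law of a run.\<close>

lemma AE_killed_workload_corner:
  assumes \<rho>: "1 < \<rho>"
  shows "AE w in M. \<forall>c. killed_workload (\<lambda>k. corner_family \<rho> z (Inr (int k + 1)) w)
      (\<lambda>k. corner_family \<rho> z (Inl (int k)) w) (if c then vinc \<rho> z w else 0) n
    = (if c \<and> (\<forall>k<n. hinc \<rho> (z + (int k + 1, 0)) w < vinc \<rho> (z + (int k + 1, 0)) w)
       then vinc \<rho> (z + (int n, 0)) w else 0)"
  using AE_square[OF \<rho>] AE_weight_eq_min[OF \<rho>] AE_vinc_pos[OF \<rho>]
proof eventually_elim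
  case (elim w)
  define J where "J k = vinc \<rho> (z + (int k, 0)) w" for k
  define I where "I k = hinc \<rho> (z + (int k + 1, - 1)) w" for k
  have sq: "hinc \<rho> (z + (int k + 1, 0)) w - J (Suc k) = I k - J k" for k
    using elim(1)[rule_format, of "z + (int k + 1, 0)"]
    by (cases z) (simp add: I_def J_def add.commute add.left_commute)
  have "J (Suc k) = Y (z + (int k + 1, 0)) w + max 0 (J k - I k)" for k
    using elim(2)[rule_format, of "z + (int k + 1, 0)"] sq[of k]
    by (simp add: J_def add.commute min_def max_def split: if_splits)
  moreover have "0 < J k" for k using elim(3) by (simp only: J_def)
  ultimately have key: "killed_workload I (\<lambda>k. Y (z + (int k + 1, 0)) w) (if c then J 0 else 0) n
    = (if c \<and> (\<forall>k<n. I k < J k) then J n else 0)" for c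
    by (intro killed_workload_eq)
  have lt: "I k < J k \<longleftrightarrow> hinc \<rho> (z + (int k + 1, 0)) w < vinc \<rho> (z + (int k + 1, 0)) w" for k
    using sq[of k] by (simp add: J_def add.commute) linarith
  have J0: "J 0 = vinc \<rho> z w"
    by (cases z) (simp add: J_def)
  have "(\<lambda>k. hinc \<rho> (z + (int k + 1, - 1)) w) = I"
    by (simp add: I_def fun_eq_iff)
  moreover have "(\<forall>k<n. I k < J k) \<longleftrightarrow>
      (\<forall>k<n. hinc \<rho> (z + (int k + 1, 0)) w < vinc \<rho> (z + (int k + 1, 0)) w)"
    using lt by blast
  ultimately show ?case
    unfolding corner_family_simps using key by (simp only: J0 J_def[of n] simp_thms)
qed

text \<open>Runs are anchored at their west end and exclude \<open>z\<close> itself, because the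
  queue evolves eastwards from the workload at \<open>z\<close>.\<close>

definition run_event :: "real \<Rightarrow> int \<times> int \<Rightarrow> nat \<Rightarrow> 'a \<Rightarrow> bool" where
  "run_event \<rho> z n w \<longleftrightarrow> (\<forall>k<n. hinc \<rho> (z + (int k + 1, 0)) w < vinc \<rho> (z + (int k + 1, 0)) w)"

lemma measurable_run_event:
  assumes \<rho>: "1 < \<rho>"
  shows "Measurable.pred M (run_event \<rho> z n)"
proof -
  note measurable_hinc[OF \<rho>, measurable] measurable_vinc[OF \<rho>, measurable]
  show ?thesis unfolding run_event_def[abs_def] by measurable
qed

text \<open>A surviving workload is positive, so its exponential is at least 1 and the moment bound
  controls the probability. The tilt \<open>\<alpha> / 2\<close> makes the contraction factor
  smallest; the constant 2 is the initial moment,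
  \<open>\<alpha> / (\<alpha> - \<alpha> / 2)\<close>.\<close>

lemma prob_run_le:
  assumes \<rho>: "1 < \<rho>"
  defines "\<alpha> \<equiv> 1 - 1 / \<rho>"
  shows "emeasure M {w \<in> space M. run_event \<rho> z n w}
    \<le> ennreal (1 / \<rho> / (1 / \<rho> + \<alpha> / 2) * (1 / (1 - \<alpha> / 2))) ^ n * ennreal 2"
proof -
  note measurable_run_event[OF \<rho>, measurable]
  define h :: "(int + int \<Rightarrow> real) \<Rightarrow> real" where "h f = - f (Inr 0)" for f
  interpret workload_chain M "corner_family \<rho> z" "{Inr (- 1), Inr 0}"
    "\<lambda>n. Inr (int n + 1)" "\<lambda>n. Inl (int n)" h "1 / \<rho>"
    by (rule workload_chain_corner[OF \<rho>]) (simp add: h_def[abs_def])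
  have \<alpha>: "0 < \<alpha>" "\<alpha> < 1" using \<rho> by (auto simp: \<alpha>_def)
  have V: "AE w in M. V k w = (if run_event \<rho> z k w then vinc \<rho> (z + (int k, 0)) w else 0)" for k
    using AE_killed_workload_corner[OF \<rho>, of z k] AE_B_swap[OF \<rho>, of "z - e2" z]
  proof eventually_elim
    case (elim w)
    have "h (restrict (\<lambda>i. corner_family \<rho> z i w) {Inr (- 1), Inr 0}) = (if True then vinc \<rho> z w else 0)"
      using elim(2) by (simp add: h_def corner_family_simps vinc_def)
    then show ?case
      by (simp only: V_def elim(1)[rule_format] run_event_def simp_thms)
  qed
  have "emeasure M {w \<in> space M. run_event \<rho> z n w} = (\<integral>\<^sup>+w. indicator {w \<in> space M. run_event \<rho> z n w} w \<partial>M)"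
    by simp
  also have "\<dots> \<le> (\<integral>\<^sup>+w. indicator {0<..} (V n w) * ennreal (exp (\<alpha> / 2 * V n w)) \<partial>M)"
  proof (rule nn_integral_mono_AE)
    show "AE w in M. indicator {w \<in> space M. run_event \<rho> z n w} w
        \<le> indicator {0<..} (V n w) * ennreal (exp (\<alpha> / 2 * V n w))"
      using V[of n] AE_vinc_pos[OF \<rho>]
    proof eventually_elim
      case (elim w)
      then show ?case
        using \<alpha> elim(2)[rule_format, of "z + (int n, 0)"] by (auto split: split_indicator)
    qed
  qed
  also have "\<dots> \<le> ennreal (1 / \<rho> / (1 / \<rho> + \<alpha> / 2) * (1 / (1 - \<alpha> / 2))) ^ n
      * (\<integral>\<^sup>+w. indicator {0<..} (V 0 w) * ennreal (exp (\<alpha> / 2 * V 0 w)) \<partial>M)"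
    using \<alpha> by (intro nn_integral_V_exp_le) auto
  also have "(\<integral>\<^sup>+w. indicator {0<..} (V 0 w) * ennreal (exp (\<alpha> / 2 * V 0 w)) \<partial>M)
    \<le> (\<integral>\<^sup>+w. ennreal (exp (\<alpha> / 2 * vinc \<rho> z w)) \<partial>M)"
    using V[of 0]
  proof (intro nn_integral_mono_AE, eventually_elim)
    case (elim w)
    then show ?case by (cases z) (auto simp: run_event_def split: split_indicator)
  qed
  also have "(\<integral>\<^sup>+w. ennreal (exp (\<alpha> / 2 * vinc \<rho> z w)) \<partial>M)
    = (\<integral>\<^sup>+x. ennreal (exponential_density \<alpha> x) * ennreal (exp (\<alpha> / 2 * x)) \<partial>lborel)"
    unfolding vinc_def \<alpha>_def by (rule distributed_nn_integral[OF vertical[OF \<rho>], symmetric]) simp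
  also have "\<dots> = ennreal 2"
    using \<alpha> by (subst nn_integral_exponential_exp) auto
  finally show ?thesis by (simp add: mult_left_mono)
qed

text \<open>A walk that moves west forever would need a workload that never empties, although its
  exponential moment contracts by a factor \<open>\<theta> < 1\<close> per step.\<close>
lemma AE_exists_turn:
  assumes \<rho>: "1 < \<rho>"
  shows "AE w in M. \<forall>l. \<exists>m\<le>l. vinc \<rho> (m, 0) w \<le> hinc \<rho> (m, 0) w"
proof -
  note measurable_hinc[OF \<rho>, measurable] measurable_vinc[OF \<rho>, measurable]
    measurable_run_event[OF \<rho>, measurable]
  define \<alpha> where "\<alpha> = 1 - 1 / \<rho>"
  define \<theta> where "\<theta> = 1 / \<rho> / (1 / \<rho> + \<alpha> / 2) * (1 / (1 - \<alpha> / 2))"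
  have \<alpha>: "0 < \<alpha>" "\<alpha> < 1" using \<rho> by (auto simp: \<alpha>_def)
  have r: "1 / \<rho> = 1 - \<alpha>" by (simp add: \<alpha>_def)
  \<comment> \<open>Since \<open>1 / \<rho> = 1 - \<alpha>\<close>, both factors equal
    \<open>1 - \<alpha> / 2\<close>; the square exceeds \<open>1 / \<rho>\<close> by
    \<open>\<alpha>\<^sup>2 / 4\<close>, which gives \<open>\<theta> < 1\<close>.\<close>
  have "(1 / \<rho> + \<alpha> / 2) * (1 - \<alpha> / 2) = 1 / \<rho> + \<alpha>\<^sup>2 / 4"
    unfolding r by (simp add: field_simps power2_eq_square)
  then have \<theta>_eq: "\<theta> = (1 / \<rho>) / (1 / \<rho> + \<alpha>\<^sup>2 / 4)"
    by (simp add: \<theta>_def)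
  have pos: "0 < 1 / \<rho>" "0 < 1 / \<rho> + \<alpha>\<^sup>2 / 4" and less: "1 / \<rho> < 1 / \<rho> + \<alpha>\<^sup>2 / 4"
    using \<rho> \<alpha> by (simp_all add: add_pos_pos)
  have \<theta>: "0 \<le> \<theta>" "\<theta> < 1"
    unfolding \<theta>_eq using less divide_nonneg_pos[OF less_imp_le[OF pos(1)] pos(2)] divide_less_eq_1_pos[OF pos(2)]
    by blast+
  have "AE w in M. \<exists>m\<le>l. vinc \<rho> (m, 0) w \<le> hinc \<rho> (m, 0) w" for l
  proof -
    define E where "E = {w \<in> space M. \<forall>m\<in>{..l}. hinc \<rho> (m, 0) w < vinc \<rho> (m, 0) w}"
    have [measurable]: "E \<in> events" unfolding E_def by measurable
    have le: "prob E \<le> \<theta> ^ n * 2" for n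
    proof -
      \<comment> \<open>Starting \<open>n\<close> columns west of \<open>l\<close>, the run covers
        exactly the last \<open>n\<close> columns up to \<open>l\<close>.\<close>
      have "emeasure M E \<le> emeasure M {w \<in> space M. run_event \<rho> (l - int n, 0) n w}"
        by (intro emeasure_mono) (auto simp: E_def run_event_def)
      also have "\<dots> \<le> ennreal \<theta> ^ n * ennreal 2"
        unfolding \<theta>_def \<alpha>_def by (rule prob_run_le[OF \<rho>])
      also have "\<dots> = ennreal (\<theta> ^ n * 2)"
        using \<theta> by (simp only: ennreal_power ennreal_mult zero_le_power zero_le_numeral)
      finally show ?thesis
        using \<theta> by (simp add: emeasure_eq_measure)
    qed
    have "(\<lambda>n. \<theta> ^ n * 2) \<longlonglongrightarrow> 0 * 2"
      using \<theta> by (intro tendsto_mult_right LIMSEQ_realpow_zero) auto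
    then have "prob E \<le> 0 * 2"
      by (rule LIMSEQ_le_const) (use le in blast)
    then have "emeasure M E = 0"
      by (simp add: emeasure_eq_measure measure_le_0_iff)
    then have "AE w in M. w \<notin> E"
      by (intro AE_not_in) auto
    then show ?thesis
      using AE_space by eventually_elim (auto simp: E_def not_less)
  qed
  then show ?thesis by (simp add: AE_all_countable)
qed

text \<open>The turn at \<open>z\<close> gives a starting workload of mass
  \<open>1 - 1 / \<rho>\<close> and rate 1; the chain then yields the law after any number of steps,
  and the probability is its total mass.\<close>

lemma prob_turn_run:
  assumes \<rho>: "1 < \<rho>"
  shows "prob {w \<in> space M. vinc \<rho> z w \<le> hinc \<rho> z w \<and> run_event \<rho> z 0 w} = 1 - 1 / \<rho>"
    and "prob {w \<in> space M. vinc \<rho> z w \<le> hinc \<rho> z w \<and> run_event \<rho> z (Suc n) w} = (1 - 1 / \<rho>) *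
      (\<Sum>k\<le>n. catalan_triangle n k * (\<rho> ^ k / (\<rho> + 1) ^ (Suc n + k)))"
proof -
  note measurable_hinc[OF \<rho>, measurable] measurable_vinc[OF \<rho>, measurable]
    measurable_run_event[OF \<rho>, measurable]
  \<comment> \<open>\<open>- f (Inr 0)\<close> is the vertical and \<open>f (Inr (- 1))\<close> the
    horizontal increment at \<open>z\<close>; the chain starts in the cemetery unless the geodesic
    turns there.\<close>
  define h :: "(int + int \<Rightarrow> real) \<Rightarrow> real"
    where "h f = (if - f (Inr 0) \<le> f (Inr (- 1)) then - f (Inr 0) else 0)" for f
  interpret workload_chain M "corner_family \<rho> z" "{Inr (- 1), Inr 0}"
    "\<lambda>n. Inr (int n + 1)" "\<lambda>n. Inl (int n)" h "1 / \<rho>"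
    by (rule workload_chain_corner[OF \<rho>]) (simp add: h_def[abs_def])
  define P where "P k = prob {w \<in> space M. vinc \<rho> z w \<le> hinc \<rho> z w \<and> run_event \<rho> z k w}" for k
  let ?c = "1 - 1 / \<rho>"
  have c: "0 < ?c" using \<rho> by simp
  have V: "AE w in M. V k w = (if vinc \<rho> z w \<le> hinc \<rho> z w \<and> run_event \<rho> z k w
      then vinc \<rho> (z + (int k, 0)) w else 0)" for k
    using AE_killed_workload_corner[OF \<rho>, of z k] AE_B_swap[OF \<rho>, of "z - e2" z]
  proof eventually_elim
    case (elim w)
    have "h (restrict (\<lambda>i. corner_family \<rho> z i w) {Inr (- 1), Inr 0}) = (if vinc \<rho> z w \<le> hinc \<rho> z w then vinc \<rho> z w else 0)"
      using elim(2) by (simp add: h_def corner_family_simps vinc_def)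
    then show ?case
      by (simp only: V_def elim(1)[rule_format] run_event_def)
  qed
  have P: "ennreal (P k) = (\<integral>\<^sup>+w. indicator {0<..} (V k w) * 1 \<partial>M)" for k
  proof -
    have "ennreal (P k) = (\<integral>\<^sup>+w. indicator {w \<in> space M. vinc \<rho> z w \<le> hinc \<rho> z w \<and> run_event \<rho> z k w} w \<partial>M)"
      by (simp add: P_def emeasure_eq_measure)
    also have "\<dots> = (\<integral>\<^sup>+w. indicator {0<..} (V k w) * 1 \<partial>M)"
    proof (rule nn_integral_cong_AE)
      show "AE w in M. indicator {w \<in> space M. vinc \<rho> z w \<le> hinc \<rho> z w \<and> run_event \<rho> z k w} w
          = (indicator {0<..} (V k w) * 1 :: ennreal)"
        using V[of k] AE_vinc_pos[OF \<rho>] AE_space[of M]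
      proof eventually_elim
        case (elim w)
        then show ?case
          using elim(2)[rule_format, of "z + (int k, 0)"] by (auto split: split_indicator)
      qed
    qed
    finally show ?thesis .
  qed
  have init: "(\<integral>\<^sup>+w. indicator {0<..} (V 0 w) * \<phi> (V 0 w) \<partial>M)
      = ennreal ?c * (\<integral>\<^sup>+y. ennreal (exponential_density 1 y) * \<phi> y \<partial>lborel)"
    if \<phi>: "\<phi> \<in> borel_measurable borel" for \<phi>
  proof -
    have "(\<integral>\<^sup>+w. indicator {0<..} (V 0 w) * \<phi> (V 0 w) \<partial>M)
      = (\<integral>\<^sup>+w. (if vinc \<rho> z w \<le> hinc \<rho> z w \<and> 0 < vinc \<rho> z w then \<phi> (vinc \<rho> z w) else 0) \<partial>M)"
      using V[of 0]
    proof (intro nn_integral_cong_AE, eventually_elim)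
      case (elim w)
      then show ?case by (cases z) (auto simp: run_event_def split: split_indicator)
    qed
    also have "\<dots> = ennreal (?c / (?c + 1 / \<rho>)) * (\<integral>\<^sup>+x. ennreal (exponential_density (?c + 1 / \<rho>) x) * \<phi> x \<partial>lborel)"
      using \<rho> c vertical[OF \<rho>, of z] horizontal[OF \<rho>, of z]
      by (intro indep_exponential_competition(2)[OF indep_vinc_hinc[OF \<rho>]]) (auto simp: vinc_def hinc_def \<phi>)
    finally show ?thesis by simp
  qed
  have "ennreal (P 0) = ennreal ?c"
    unfolding P by (subst init) (simp_all add: nn_integral_erlang)
  then show "prob {w \<in> space M. vinc \<rho> z w \<le> hinc \<rho> z w \<and> run_event \<rho> z 0 w} = ?c"
    using c by (simp add: P_def)
  have nonneg: "0 \<le> catalan_triangle n k * (\<rho> ^ k / (\<rho> + 1) ^ (Suc n + k))" if "k \<le> n" for k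
    using \<rho> that by (intro mult_nonneg_nonneg catalan_triangle_nonneg) auto
  \<comment> \<open>Test function 1: each Erlang law has total mass 1, so only the weights
    remain.\<close>
  have "ennreal (P (Suc n)) = ennreal ?c * (\<Sum>k\<le>n. ennreal (catalan_triangle n k *
      ((1 / \<rho> / (1 + 1 / \<rho>)) ^ Suc n * (1 / (1 + 1 / \<rho>)) ^ k)) *
      (\<integral>\<^sup>+y. ennreal (erlang_density (Suc n - k) 1 y) * 1 \<partial>lborel))"
    unfolding P by (rule nn_integral_V_catalan[OF init]) simp_all
  also have "\<dots> = ennreal ?c * (\<Sum>k\<le>n. ennreal (catalan_triangle n k * (\<rho> ^ k / (\<rho> + 1) ^ (Suc n + k))))"
  proof -
    have "1 / \<rho> / (1 + 1 / \<rho>) = 1 / (\<rho> + 1)" "1 / (1 + 1 / \<rho>) = \<rho> / (\<rho> + 1)"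
      using \<rho> by (simp_all add: field_simps)
    then have "(1 / \<rho> / (1 + 1 / \<rho>)) ^ Suc n * (1 / (1 + 1 / \<rho>)) ^ k = \<rho> ^ k / (\<rho> + 1) ^ (Suc n + k)" for k
      by (simp add: power_divide power_add)
    then show ?thesis by (simp add: nn_integral_erlang)
  qed
  also have "\<dots> = ennreal (?c * (\<Sum>k\<le>n. catalan_triangle n k * (\<rho> ^ k / (\<rho> + 1) ^ (Suc n + k))))"
    using c nonneg by (subst sum_ennreal) (auto simp only: ennreal_mult' less_imp_le atMost_iff)
  finally have eq: "ennreal (P (Suc n)) = ennreal (?c * (\<Sum>k\<le>n. catalan_triangle n k * (\<rho> ^ k / (\<rho> + 1) ^ (Suc n + k))))" .
  have "0 \<le> P (Suc n)"
    by (simp add: P_def)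
  moreover have "0 \<le> ?c * (\<Sum>k\<le>n. catalan_triangle n k * (\<rho> ^ k / (\<rho> + 1) ^ (Suc n + k)))"
    using c by (intro mult_nonneg_nonneg sum_nonneg nonneg) auto
  ultimately show "prob {w \<in> space M. vinc \<rho> z w \<le> hinc \<rho> z w \<and> run_event \<rho> z (Suc n) w}
      = ?c * (\<Sum>k\<le>n. catalan_triangle n k * (\<rho> ^ k / (\<rho> + 1) ^ (Suc n + k)))"
    using eq unfolding P_def by (rule ennreal_inj[THEN iffD1])
qed

section \<open>Westward runs of the geodesic, read from their west end\<close>

lemma geodesic_step_eq:
  "geodesic_step B \<rho> x w = - e1 \<longleftrightarrow> hinc \<rho> x w < vinc \<rho> x w"
  "geodesic_step B \<rho> x w = - e2 \<longleftrightarrow> vinc \<rho> x w \<le> hinc \<rho> x w"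
  by (auto simp: geodesic_step_def hinc_def vinc_def)

text \<open>The infimum is \<open>n\<close> iff the first turn is at \<open>x - (n, 0)\<close>.
  Reversing the order of the \<open>n\<close> sites before it turns the westward run into a
  \<open>run_event\<close> seen from the turning site.\<close>

lemma horizontal_run_eq_iff:
  "horizontal_run B \<rho> x w = enat n \<longleftrightarrow>
    vinc \<rho> (x - (int n, 0)) w \<le> hinc \<rho> (x - (int n, 0)) w \<and> run_event \<rho> (x - (int n, 0)) n w"
proof -
  define T where "T k \<longleftrightarrow> vinc \<rho> (x - (int k, 0)) w \<le> hinc \<rho> (x - (int k, 0)) w" for k
  have run: "horizontal_run B \<rho> x w = Inf (enat ` {k. T k})"
    unfolding horizontal_run_def geodesic_step_eq T_def setcompr_eq_image ..
  have "Inf (enat ` {k. T k}) = enat n \<longleftrightarrow> T n \<and> (\<forall>k<n. \<not> T k)"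
  proof
    assume *: "Inf (enat ` {k. T k}) = enat n"
    \<comment> \<open>A geodesic without a turn would give the infimum
      \<open>\<infinity>\<close>.\<close>
    then have "enat ` {k. T k} \<noteq> {}" by (auto simp: Inf_enat_def split: if_splits)
    then have "Inf (enat ` {k. T k}) \<in> enat ` {k. T k}" by (rule wellorder_InfI[OF ex_in_conv[THEN iffD2, THEN someI_ex]])
    with * have "T n" by auto
    moreover have "\<not> T k" if "k < n" for k
    proof
      assume "T k"
      then have "Inf (enat ` {k. T k}) \<le> enat k" by (intro Inf_lower) auto
      with * that show False by simp
    qed
    ultimately show "T n \<and> (\<forall>k<n. \<not> T k)" by blast
  next
    assume "T n \<and> (\<forall>k<n. \<not> T k)"
    then show "Inf (enat ` {k. T k}) = enat n"
      by (intro Inf_eqI) (auto simp: not_less[symmetric])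
  qed
  moreover have "(\<forall>k<n. \<not> T k) \<longleftrightarrow> run_event \<rho> (x - (int n, 0)) n w"
  proof -
    have eq: "x - (int n, 0) + (int (n - Suc k) + 1, 0) = x - (int k, 0)" if "k < n" for k
      using that by (cases x) simp
    have rev: "(\<forall>k<n. Q k) \<longleftrightarrow> (\<forall>k<n. Q (n - Suc k))" for Q
    proof (intro iffI allI impI)
      fix k assume *: "\<forall>k<n. Q (n - Suc k)" and k: "k < n"
      then have "n - Suc k < n" "n - Suc (n - Suc k) = k" by simp_all
      with * show "Q k" by metis
    qed simp
    have "run_event \<rho> (x - (int n, 0)) n w \<longleftrightarrow> (\<forall>k<n. hinc \<rho> (x - (int k, 0)) w < vinc \<rho> (x - (int k, 0)) w)"
      unfolding run_event_def by (subst rev) (simp only: eq cong: conj_cong imp_cong)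
    then show ?thesis
      by (simp add: T_def not_le)
  qed
  ultimately show ?thesis by (simp add: run T_def)
qed

lemma prob_horizontal_run:
  assumes \<rho>: "1 < \<rho>"
  shows "prob {w \<in> space M. horizontal_run B \<rho> x w = 0} = 1 - 1 / \<rho>"
    and "0 < n \<Longrightarrow> prob {w \<in> space M. horizontal_run B \<rho> x w = enat n} = (1 - 1 / \<rho>) *
      (\<Sum>k=0..n - 1. catalan_triangle (n - 1) k * (\<rho> ^ k / (\<rho> + 1) ^ (n + k)))"
proof -
  show "prob {w \<in> space M. horizontal_run B \<rho> x w = 0} = 1 - 1 / \<rho>"
    using prob_turn_run(1)[OF \<rho>, of "x - (int 0, 0)"] by (simp only: zero_enat_def horizontal_run_eq_iff)
  assume "0 < n"
  then obtain m where n: "n = Suc m" by (cases n) auto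
  show "prob {w \<in> space M. horizontal_run B \<rho> x w = enat n} = (1 - 1 / \<rho>) *
      (\<Sum>k=0..n - 1. catalan_triangle (n - 1) k * (\<rho> ^ k / (\<rho> + 1) ^ (n + k)))"
    unfolding n horizontal_run_eq_iff prob_turn_run(2)[OF \<rho>] by (simp add: atMost_atLeast0)
qed

section \<open>Geodesic steps along a row as a function of arrivals and services\<close>

lemma AE_departure_eq:
  assumes \<rho>: "1 < \<rho>"
  shows "AE w in M. \<forall>k. geodesic_step B \<rho> (k, 0) w = - e1 \<longleftrightarrow>
    departure (\<lambda>j. hinc \<rho> (j, - 1) w) (\<lambda>j. Y (j, 0) w) k = Y (k, 0) w"
proof -
  \<comment> \<open>At a tie the geodesic steps down although the horizontal increment equals the
    weight; only off ties does equality with the weight characterise a west step.\<close>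
  have "AE w in M. vinc \<rho> x w \<noteq> hinc \<rho> x w" for x
    using \<rho> vertical[OF \<rho>, of x] horizontal[OF \<rho>, of x]
    by (intro indep_exponential_competition(1)[OF indep_vinc_hinc[OF \<rho>]]) (auto simp: vinc_def hinc_def)
  then have "AE w in M. \<forall>x. vinc \<rho> x w \<noteq> hinc \<rho> x w"
    by (simp add: AE_all_countable)
  then show ?thesis
    using AE_square[OF \<rho>] AE_weight_eq_min[OF \<rho>] AE_exists_turn[OF \<rho>]
  proof eventually_elim
    case (elim w)
    have dep: "departure (\<lambda>j. hinc \<rho> (j, - 1) w) (\<lambda>j. Y (j, 0) w) k = hinc \<rho> (k, 0) w" for k
    proof (rule departure_eqI[where J = "\<lambda>k. vinc \<rho> (k, 0) w"])
      show "hinc \<rho> (k, 0) w - vinc \<rho> (k, 0) w = hinc \<rho> (k, - 1) w - vinc \<rho> (k - 1, 0) w" for k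
        using elim(2)[rule_format, of "(k, 0)"] by simp
    qed (use elim in auto)
    have "hinc \<rho> (k, 0) w < vinc \<rho> (k, 0) w \<longleftrightarrow> hinc \<rho> (k, 0) w = Y (k, 0) w" for k
      using elim(1)[rule_format, of "(k, 0)"] elim(3)[rule_format, of "(k, 0)"]
      by (auto simp: min_def less_le)
    then show ?case
      unfolding geodesic_step_eq dep by blast
  qed
qed

text \<open>Both sequences are images, up to a null set, of a pair of independent i.i.d. sequences
  under one map \<open>\<Phi>\<close>. The laws of the pairs coincide, and measurability of
  \<open>\<Phi>\<close> on the whole sequence space transfers this to the images.\<close>

lemma equal_in_distribution_departure:
  fixes N :: "'b measure"
  assumes \<rho>: "1 < \<rho>" and N: "prob_space N"
    and \<omega>: "iid_exponential N 1 \<omega>" and I: "iid_exponential N (1 / \<rho>) I"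
    and ind: "prob_space.indep_var N
      (PiM UNIV (\<lambda>_. borel)) (\<lambda>s k. \<omega> k s) (PiM UNIV (\<lambda>_. borel)) (\<lambda>s k. I k s)"
  shows "equal_in_distribution
    M (\<lambda>w k. of_bool (geodesic_step B \<rho> (k, 0) w = - e1))
    N (\<lambda>s k. of_bool (departure (\<lambda>j. I j s) (\<lambda>j. \<omega> j s) k = \<omega> k s))
    (PiM (UNIV :: int set) (\<lambda>_. borel :: real measure))"
proof -
  interpret N: prob_space N by (rule N)
  let ?P = "PiM (UNIV :: int set) (\<lambda>_. borel :: real measure)"
  define \<Phi> :: "(int \<Rightarrow> real) \<times> (int \<Rightarrow> real) \<Rightarrow> int \<Rightarrow> real"
    where "\<Phi> = (\<lambda>(u, v) k. of_bool (departure v u k = u k))"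
  have \<Phi> [measurable]: "\<Phi> \<in> measurable (?P \<Otimes>\<^sub>M ?P) ?P"
  proof (rule measurable_PiM_single')
    fix k :: int
    have [measurable]: "(\<lambda>x. fst x i) \<in> borel_measurable (?P \<Otimes>\<^sub>M ?P)"
      "(\<lambda>x. snd x i) \<in> borel_measurable (?P \<Otimes>\<^sub>M ?P)" for i
      by measurable
    have [measurable]: "(\<lambda>x. departure (snd x) (fst x) k) \<in> borel_measurable (?P \<Otimes>\<^sub>M ?P)"
      by measurable
    show "(\<lambda>x. \<Phi> x k) \<in> borel_measurable (?P \<Otimes>\<^sub>M ?P)"
      unfolding \<Phi>_def case_prod_beta' by measurable
  qed simp
  define a where "a w k = (of_bool (geodesic_step B \<rho> (k, 0) w = - e1) :: real)" for w k
  have a: "a \<in> measurable M ?P"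
  proof (rule measurable_PiM_single')
    note measurable_hinc[OF \<rho>, measurable] measurable_vinc[OF \<rho>, measurable]
    show "(\<lambda>w. a w k) \<in> borel_measurable M" for k
      unfolding a_def geodesic_step_eq by measurable
  qed simp
  have Y: "iid_exponential M 1 (\<lambda>k. Y (k, 0))"
    using weights indep_vars_reindex_inj[of borel Y "\<lambda>k :: int. (k, 0)"]
    unfolding iid_exponential_def by (auto intro: injI)
  have H: "iid_exponential M (1 / \<rho>) (\<lambda>k. hinc \<rho> (k, - 1))"
  proof -
    have "down_right_path (\<lambda>k. (k - 1, - 1))"
      by (simp add: down_right_path_def)
    from down_right_independent[OF \<rho> this]
    have "indep_vars (\<lambda>_. borel) (\<lambda>k. hinc \<rho> (k, - 1)) UNIV"
      by (simp add: hinc_def)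
    then show ?thesis
      unfolding iid_exponential_def using horizontal[OF \<rho>, of "(i, - 1)" for i] by (simp add: hinc_def)
  qed
  have YH: "indep_var ?P (\<lambda>w k. Y (k, 0) w) ?P (\<lambda>w k. hinc \<rho> (k, - 1) w)"
  proof -
    have "southwest_closed {x. snd x < 0}"
      by (auto simp: southwest_closed_def)
    moreover have "range (\<lambda>k :: int. (k - 1 :: int, - 1 :: int)) \<subseteq> {x. snd x < 0}"
      "range (\<lambda>k :: int. (k :: int, 0 :: int)) \<inter> {x. snd x < 0} = {}"
      by auto
    ultimately show ?thesis
      using indep_weights_increments[OF \<rho>, of "{x. snd x < 0}" "\<lambda>k. (k - 1, - 1)" "\<lambda>k. (k, 0)"]
      by (simp add: hinc_def)
  qed
  have joint: "distr M (?P \<Otimes>\<^sub>M ?P) (\<lambda>w. (\<lambda>k. Y (k, 0) w, \<lambda>k. hinc \<rho> (k, - 1) w))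
    = distr N (?P \<Otimes>\<^sub>M ?P) (\<lambda>s. (\<lambda>k. \<omega> k s, \<lambda>k. I k s))"
    using YH ind
    unfolding indep_var_distribution_eq N.indep_var_distribution_eq
      iid_exponential_law[OF Y] iid_exponential_law[OF H] N.iid_exponential_law[OF \<omega>] N.iid_exponential_law[OF I]
    by simp
  have mM [measurable]: "(\<lambda>w. (\<lambda>k. Y (k, 0) w, \<lambda>k. hinc \<rho> (k, - 1) w)) \<in> measurable M (?P \<Otimes>\<^sub>M ?P)"
    using YH by (auto simp: indep_var_distribution_eq)
  have mN [measurable]: "(\<lambda>s. (\<lambda>k. \<omega> k s, \<lambda>k. I k s)) \<in> measurable N (?P \<Otimes>\<^sub>M ?P)"
    using ind by (auto simp: N.indep_var_distribution_eq)
  have "distr M ?P a = distr M ?P (\<lambda>w. \<Phi> (\<lambda>k. Y (k, 0) w, \<lambda>k. hinc \<rho> (k, - 1) w))"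
  proof (rule distr_cong_AE)
    show "AE w in M. a w = \<Phi> (\<lambda>k. Y (k, 0) w, \<lambda>k. hinc \<rho> (k, - 1) w)"
      using AE_departure_eq[OF \<rho>] by eventually_elim (simp add: a_def \<Phi>_def fun_eq_iff)
  qed (use a in auto)
  also have "\<dots> = distr (distr M (?P \<Otimes>\<^sub>M ?P) (\<lambda>w. (\<lambda>k. Y (k, 0) w, \<lambda>k. hinc \<rho> (k, - 1) w))) ?P \<Phi>"
    by (subst distr_distr) (auto simp: comp_def)
  also have "\<dots> = distr N ?P (\<lambda>s. \<Phi> (\<lambda>k. \<omega> k s, \<lambda>k. I k s))"
    unfolding joint by (subst distr_distr) (auto simp: comp_def)
  finally have "distr M ?P a = distr N ?P (\<lambda>s. \<Phi> (\<lambda>k. \<omega> k s, \<lambda>k. I k s))" .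
  moreover have "(\<lambda>s. \<Phi> (\<lambda>k. \<omega> k s, \<lambda>k. I k s)) \<in> measurable N ?P"
    by measurable
  ultimately show ?thesis
    using a unfolding equal_in_distribution_def a_def[abs_def] \<Phi>_def by simp
qed

end

theorem theorem3p6:
  fixes M :: "'a measure" and Y :: "int \<times> int \<Rightarrow> 'a \<Rightarrow> real"
    and B :: "real \<Rightarrow> int \<times> int \<Rightarrow> int \<times> int \<Rightarrow> 'a \<Rightarrow> real" and \<rho> :: real
  assumes "busemann_process M Y B" and "1 < \<rho>"
  shows "(\<forall>(N :: 'b measure) (\<omega> :: int \<Rightarrow> 'b \<Rightarrow> real) (I :: int \<Rightarrow> 'b \<Rightarrow> real).
            prob_space N \<longrightarrow>
            iid_exponential N 1 \<omega> \<longrightarrow>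
            iid_exponential N (1 / \<rho>) I \<longrightarrow>
            prob_space.indep_var N
              (PiM UNIV (\<lambda>_. borel)) (\<lambda>s k. \<omega> k s) (PiM UNIV (\<lambda>_. borel)) (\<lambda>s k. I k s) \<longrightarrow>
            equal_in_distribution
              M (\<lambda>w k. of_bool (geodesic_step B \<rho> (k, 0) w = - e1))
              N (\<lambda>s k. of_bool (departure (\<lambda>j. I j s) (\<lambda>j. \<omega> j s) k = \<omega> k s))
              (PiM (UNIV :: int set) (\<lambda>_. borel :: real measure)))
       \<and> (\<forall>x. measure M {w \<in> space M. horizontal_run B \<rho> x w = 0} = 1 - 1 / \<rho> \<and>
            (\<forall>n>0. measure M {w \<in> space M. horizontal_run B \<rho> x w = enat n} =
               (1 - 1 / \<rho>) *
               (\<Sum>k=0..n - 1. catalan_triangle (n - 1) k * (\<rho> ^ k / (\<rho> + 1) ^ (n + k)))))"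
proof -
  interpret busemann_process M Y B by fact
  show ?thesis
    using prob_horizontal_run[OF \<open>1 < \<rho>\<close>] equal_in_distribution_departure[OF \<open>1 < \<rho>\<close>] by blast
qed

end
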